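(* Let $k$ be a commutative ring, let $\mathcal{A}$ be a Krull-Schmidt $k$-category, and suppose $X\xrightarrow{f}Y\xrightarrow{g}Z$ is an Auslander-Reiten sequence in $\mathcal{A}$ with $Y\neq 0$. (i) Up to isomorphism, $X\xrightarrow{f}Y\xrightarrow{g}Z$ is the unique Auslander-Reiten sequence starting at $X$ and the unique one ending at $Z$. (ii) Any irreducible morphism $f_1\colon X\to Y_1$ or $g_1\colon Y_1\to Z$ fits into an Auslander-Reiten sequence $$X\xrightarrow{\begin{pmatrix}f_1\\ f_2\end{pmatrix}}Y_1\oplus Y_2\xrightarrow{\begin{pmatrix}g_1& g_2\end{pmatrix}}Z.$$
   Context: A $k$-category is an additive category whose Hom-sets are $k$-modules and whose composition is $k$-bilinear. An additive category is Krull-Schmidt if every object is a finite direct sum of objects with local endomorphism rings; no Hom-finiteness is assumed. A morphism $f\colon X\to Y$ is right almost split if it is not a retraction and every non-retraction $u\colon U\to Y$ factors as $u=f\hat u$; it is right minimal if $fg=f$ with $g\colon X\to X$ implies $g$ is an automorphism; it is minimal right almost split if both hold. Minimal left almost split is defined dually. A weak kernel of $f\colon X\to Y$ is a morphism $w\colon W\to X$ with $fw=0$ such that every $g\colon V\to X$ with $fg=0$ factors (not necessarily uniquely) through $w$; weak cokernels are dual. An Auslander-Reiten sequence is a sequence $X\xrightarrow{f}Y\xrightarrow{g}Z$ such that $f$ is a weak kernel of $g$, $g$ is a weak cokernel of $f$, $f$ is minimal left almost split, and $g$ is minimal right almost split. It starts at $X$ and ends at $Z$. An isomorphism of sequences is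 a commutative diagram between them whose three vertical morphisms are isomorphisms. A morphism $f\colon X\to Y$ is irreducible if it is neither a section nor a retraction, and whenever $f=hg$, either $h$ is a retraction or $g$ is a section. *)

theory Defs
  imports "HOL-Algebra.Module"
begin

section \<open>Categories over a commutative ring\<close>

text \<open>
  A category is given by a set of objects, a Hom-module for every pair of objects, composition
  (written in applicative order) and identities.  The Hom-sets need not be pairwise
  disjoint: domain and codomain are passed explicitly to every notion that depends on them.
  The type \<open>('k, 'm) module\<close> of Hom-modules has ring multiplication and unit fields,
  which are never used here.
\<close>

record ('o, 'm, 'k) lin_cat =
  Obj :: "'o set"
  Hom :: "'o \<Rightarrow> 'o \<Rightarrow> ('k, 'm) module"
  cmp :: "'m \<Rightarrow> 'm \<Rightarrow> 'm"  (infixl "\<cdot>\<index>" 75)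
  idm :: "'o \<Rightarrow> 'm"

definition mor :: "('o, 'm, 'k) lin_cat \<Rightarrow> 'o \<Rightarrow> 'o \<Rightarrow> 'm set" where
  "mor C X Y = {f. X \<in> Obj C \<and> Y \<in> Obj C \<and> f \<in> carrier (Hom C X Y)}"

locale linear_category = cring K
  for K :: "('k, 'c) ring_scheme" (structure) and C :: "('o, 'm, 'k) lin_cat" (structure) +
  assumes hom_module: "\<lbrakk>X \<in> Obj C; Y \<in> Obj C\<rbrakk> \<Longrightarrow> module K (Hom C X Y)"
    and id_mor: "X \<in> Obj C \<Longrightarrow> idm C X \<in> mor C X X"
    and cmp_mor: "\<lbrakk>f \<in> mor C X Y; g \<in> mor C Y Z\<rbrakk> \<Longrightarrow> g \<cdot>\<^bsub>C\<^esub> f \<in> mor C X Z"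
    and cmp_assoc: "\<lbrakk>f \<in> mor C X Y; g \<in> mor C Y Z; h \<in> mor C Z W\<rbrakk>
          \<Longrightarrow> (h \<cdot>\<^bsub>C\<^esub> g) \<cdot>\<^bsub>C\<^esub> f = h \<cdot>\<^bsub>C\<^esub> (g \<cdot>\<^bsub>C\<^esub> f)"
    and id_left: "f \<in> mor C X Y \<Longrightarrow> idm C Y \<cdot>\<^bsub>C\<^esub> f = f"
    and id_right: "f \<in> mor C X Y \<Longrightarrow> f \<cdot>\<^bsub>C\<^esub> idm C X = f"
    and cmp_add_left: "\<lbrakk>f \<in> mor C X Y; g \<in> mor C Y Z; g' \<in> mor C Y Z\<rbrakk>
          \<Longrightarrow> (g \<oplus>\<^bsub>Hom C Y Z\<^esub> g') \<cdot>\<^bsub>C\<^esub> f = g \<cdot>\<^bsub>C\<^esub> f \<oplus>\<^bsub>Hom C X Z\<^esub> g' \<cdot>\<^bsub>C\<^esub> f"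
    and cmp_add_right: "\<lbrakk>f \<in> mor C X Y; f' \<in> mor C X Y; g \<in> mor C Y Z\<rbrakk>
          \<Longrightarrow> g \<cdot>\<^bsub>C\<^esub> (f \<oplus>\<^bsub>Hom C X Y\<^esub> f') = g \<cdot>\<^bsub>C\<^esub> f \<oplus>\<^bsub>Hom C X Z\<^esub> g \<cdot>\<^bsub>C\<^esub> f'"
    and cmp_smult_left: "\<lbrakk>a \<in> carrier K; f \<in> mor C X Y; g \<in> mor C Y Z\<rbrakk>
          \<Longrightarrow> (a \<odot>\<^bsub>Hom C Y Z\<^esub> g) \<cdot>\<^bsub>C\<^esub> f = a \<odot>\<^bsub>Hom C X Z\<^esub> (g \<cdot>\<^bsub>C\<^esub> f)"
    and cmp_smult_right: "\<lbrakk>a \<in> carrier K; f \<in> mor C X Y; g \<in> mor C Y Z\<rbrakk>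
          \<Longrightarrow> g \<cdot>\<^bsub>C\<^esub> (a \<odot>\<^bsub>Hom C X Y\<^esub> f) = a \<odot>\<^bsub>Hom C X Z\<^esub> (g \<cdot>\<^bsub>C\<^esub> f)"

definition zero_object :: "('o, 'm, 'k) lin_cat \<Rightarrow> 'o \<Rightarrow> bool" where
  "zero_object C N \<longleftrightarrow> N \<in> Obj C \<and>
     (\<forall>X\<in>Obj C. (\<exists>!f. f \<in> mor C X N) \<and> (\<exists>!f. f \<in> mor C N X))"

text \<open>\<open>W\<close> is a direct sum of \<open>X\<close> and \<open>Y\<close> with injections \<open>i\<^sub>1, i\<^sub>2\<close>
  and projections \<open>p\<^sub>1, p\<^sub>2\<close>.\<close>

definition biproduct ::
    "('o, 'm, 'k) lin_cat \<Rightarrow> 'o \<Rightarrow> 'o \<Rightarrow> 'o \<Rightarrow> 'm \<Rightarrow> 'm \<Rightarrow> 'm \<Rightarrow> 'm \<Rightarrow> bool" where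
  "biproduct C X Y W i\<^sub>1 i\<^sub>2 p\<^sub>1 p\<^sub>2 \<longleftrightarrow>
     i\<^sub>1 \<in> mor C X W \<and> i\<^sub>2 \<in> mor C Y W \<and> p\<^sub>1 \<in> mor C W X \<and> p\<^sub>2 \<in> mor C W Y \<and>
     p\<^sub>1 \<cdot>\<^bsub>C\<^esub> i\<^sub>1 = idm C X \<and> p\<^sub>2 \<cdot>\<^bsub>C\<^esub> i\<^sub>2 = idm C Y \<and>
     p\<^sub>2 \<cdot>\<^bsub>C\<^esub> i\<^sub>1 = \<zero>\<^bsub>Hom C X Y\<^esub> \<and> p\<^sub>1 \<cdot>\<^bsub>C\<^esub> i\<^sub>2 = \<zero>\<^bsub>Hom C Y X\<^esub> \<and>
     i\<^sub>1 \<cdot>\<^bsub>C\<^esub> p\<^sub>1 \<oplus>\<^bsub>Hom C W W\<^esub> i\<^sub>2 \<cdot>\<^bsub>C\<^esub> p\<^sub>2 = idm C W"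

definition direct_sum ::
    "('o, 'm, 'k) lin_cat \<Rightarrow> nat \<Rightarrow> (nat \<Rightarrow> 'o) \<Rightarrow> 'o \<Rightarrow> (nat \<Rightarrow> 'm) \<Rightarrow> (nat \<Rightarrow> 'm) \<Rightarrow> bool" where
  "direct_sum C n X W i p \<longleftrightarrow> W \<in> Obj C \<and>
     (\<forall>j<n. i j \<in> mor C (X j) W \<and> p j \<in> mor C W (X j)) \<and>
     (\<forall>j<n. \<forall>l<n. p l \<cdot>\<^bsub>C\<^esub> i j = (if j = l then idm C (X j) else \<zero>\<^bsub>Hom C (X j) (X l)\<^esub>)) \<and>
     (\<Oplus>\<^bsub>Hom C W W\<^esub>j\<in>{..<n}. i j \<cdot>\<^bsub>C\<^esub> p j) = idm C W"

locale k_category = linear_category +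
  assumes zero_object_exists: "\<exists>N. zero_object C N"
    and biproduct_exists: "\<lbrakk>X \<in> Obj C; Y \<in> Obj C\<rbrakk>
          \<Longrightarrow> \<exists>W i\<^sub>1 i\<^sub>2 p\<^sub>1 p\<^sub>2. biproduct C X Y W i\<^sub>1 i\<^sub>2 p\<^sub>1 p\<^sub>2"

definition end_ring :: "('o, 'm, 'k) lin_cat \<Rightarrow> 'o \<Rightarrow> 'm ring" where
  "end_ring C X = \<lparr>carrier = mor C X X, monoid.mult = cmp C, one = idm C X,
     zero = \<zero>\<^bsub>Hom C X X\<^esub>, add = add (Hom C X X)\<rparr>"

text \<open>Local rings need not be commutative; \<open>Units R\<close> consists of the two-sided units.\<close>

locale local_ring = ring R for R (structure) +
  assumes nontrivial: "\<one> \<noteq> \<zero>"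
    and nonunits_add: "\<lbrakk>x \<in> carrier R - Units R; y \<in> carrier R - Units R\<rbrakk>
          \<Longrightarrow> x \<oplus> y \<in> carrier R - Units R"

text \<open>The case \<open>n = 0\<close> below is the zero object as the empty direct sum.\<close>

locale krull_schmidt_category = k_category +
  assumes krull_schmidt: "W \<in> Obj C \<Longrightarrow>
    \<exists>n X i p. direct_sum C n X W i p \<and> (\<forall>j<n. local_ring (end_ring C (X j)))"


section \<open>Auslander-Reiten sequences\<close>

text \<open>For predicates on a morphism, the arguments are ordered as in \<open>f : X \<rightarrow> Y\<close>: the domain
  \<open>X\<close>, then \<open>f\<close>, then the codomain \<open>Y\<close>.\<close>

definition is_section :: "('o, 'm, 'k) lin_cat \<Rightarrow> 'o \<Rightarrow> 'm \<Rightarrow> 'o \<Rightarrow> bool" where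
  "is_section C X f Y \<longleftrightarrow> f \<in> mor C X Y \<and> (\<exists>r\<in>mor C Y X. r \<cdot>\<^bsub>C\<^esub> f = idm C X)"

definition is_retraction :: "('o, 'm, 'k) lin_cat \<Rightarrow> 'o \<Rightarrow> 'm \<Rightarrow> 'o \<Rightarrow> bool" where
  "is_retraction C X f Y \<longleftrightarrow> f \<in> mor C X Y \<and> (\<exists>s\<in>mor C Y X. f \<cdot>\<^bsub>C\<^esub> s = idm C Y)"

definition is_iso :: "('o, 'm, 'k) lin_cat \<Rightarrow> 'o \<Rightarrow> 'm \<Rightarrow> 'o \<Rightarrow> bool" where
  "is_iso C X f Y \<longleftrightarrow> f \<in> mor C X Y \<and>
     (\<exists>g\<in>mor C Y X. g \<cdot>\<^bsub>C\<^esub> f = idm C X \<and> f \<cdot>\<^bsub>C\<^esub> g = idm C Y)"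

definition right_almost_split :: "('o, 'm, 'k) lin_cat \<Rightarrow> 'o \<Rightarrow> 'm \<Rightarrow> 'o \<Rightarrow> bool" where
  "right_almost_split C X f Y \<longleftrightarrow> f \<in> mor C X Y \<and> \<not> is_retraction C X f Y \<and>
     (\<forall>U. \<forall>u\<in>mor C U Y. \<not> is_retraction C U u Y \<longrightarrow> (\<exists>v\<in>mor C U X. u = f \<cdot>\<^bsub>C\<^esub> v))"

definition left_almost_split :: "('o, 'm, 'k) lin_cat \<Rightarrow> 'o \<Rightarrow> 'm \<Rightarrow> 'o \<Rightarrow> bool" where
  "left_almost_split C X f Y \<longleftrightarrow> f \<in> mor C X Y \<and> \<not> is_section C X f Y \<and>
     (\<forall>U. \<forall>u\<in>mor C X U. \<not> is_section C X u U \<longrightarrow> (\<exists>v\<in>mor C Y U. u = v \<cdot>\<^bsub>C\<^esub> f))"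

definition right_minimal :: "('o, 'm, 'k) lin_cat \<Rightarrow> 'o \<Rightarrow> 'm \<Rightarrow> 'o \<Rightarrow> bool" where
  "right_minimal C X f Y \<longleftrightarrow> f \<in> mor C X Y \<and>
     (\<forall>g\<in>mor C X X. f \<cdot>\<^bsub>C\<^esub> g = f \<longrightarrow> is_iso C X g X)"

definition left_minimal :: "('o, 'm, 'k) lin_cat \<Rightarrow> 'o \<Rightarrow> 'm \<Rightarrow> 'o \<Rightarrow> bool" where
  "left_minimal C X f Y \<longleftrightarrow> f \<in> mor C X Y \<and>
     (\<forall>g\<in>mor C Y Y. g \<cdot>\<^bsub>C\<^esub> f = f \<longrightarrow> is_iso C Y g Y)"

definition minimal_right_almost_split :: "('o, 'm, 'k) lin_cat \<Rightarrow> 'o \<Rightarrow> 'm \<Rightarrow> 'o \<Rightarrow> bool" where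
  "minimal_right_almost_split C X f Y \<longleftrightarrow> right_almost_split C X f Y \<and> right_minimal C X f Y"

definition minimal_left_almost_split :: "('o, 'm, 'k) lin_cat \<Rightarrow> 'o \<Rightarrow> 'm \<Rightarrow> 'o \<Rightarrow> bool" where
  "minimal_left_almost_split C X f Y \<longleftrightarrow> left_almost_split C X f Y \<and> left_minimal C X f Y"

text \<open>\<open>w : W \<rightarrow> X\<close> is a weak kernel of \<open>f : X \<rightarrow> Y\<close>.\<close>

definition weak_kernel ::
    "('o, 'm, 'k) lin_cat \<Rightarrow> 'o \<Rightarrow> 'm \<Rightarrow> 'o \<Rightarrow> 'm \<Rightarrow> 'o \<Rightarrow> bool" where
  "weak_kernel C W w X f Y \<longleftrightarrow> w \<in> mor C W X \<and> f \<in> mor C X Y \<and>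
     f \<cdot>\<^bsub>C\<^esub> w = \<zero>\<^bsub>Hom C W Y\<^esub> \<and>
     (\<forall>V. \<forall>g\<in>mor C V X. f \<cdot>\<^bsub>C\<^esub> g = \<zero>\<^bsub>Hom C V Y\<^esub> \<longrightarrow> (\<exists>h\<in>mor C V W. g = w \<cdot>\<^bsub>C\<^esub> h))"

text \<open>\<open>w : Y \<rightarrow> W\<close> is a weak cokernel of \<open>f : X \<rightarrow> Y\<close>.\<close>

definition weak_cokernel ::
    "('o, 'm, 'k) lin_cat \<Rightarrow> 'o \<Rightarrow> 'm \<Rightarrow> 'o \<Rightarrow> 'm \<Rightarrow> 'o \<Rightarrow> bool" where
  "weak_cokernel C X f Y w W \<longleftrightarrow> f \<in> mor C X Y \<and> w \<in> mor C Y W \<and>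
     w \<cdot>\<^bsub>C\<^esub> f = \<zero>\<^bsub>Hom C X W\<^esub> \<and>
     (\<forall>V. \<forall>g\<in>mor C Y V. g \<cdot>\<^bsub>C\<^esub> f = \<zero>\<^bsub>Hom C X V\<^esub> \<longrightarrow> (\<exists>h\<in>mor C W V. g = h \<cdot>\<^bsub>C\<^esub> w))"

definition AR_sequence ::
    "('o, 'm, 'k) lin_cat \<Rightarrow> 'o \<Rightarrow> 'm \<Rightarrow> 'o \<Rightarrow> 'm \<Rightarrow> 'o \<Rightarrow> bool" where
  "AR_sequence C X f Y g Z \<longleftrightarrow>
     weak_kernel C X f Y g Z \<and> weak_cokernel C X f Y g Z \<and>
     minimal_left_almost_split C X f Y \<and> minimal_right_almost_split C Y g Z"

definition sequence_iso :: "('o, 'm, 'k) lin_cat \<Rightarrow> 'o \<Rightarrow> 'm \<Rightarrow> 'o \<Rightarrow> 'm \<Rightarrow> 'o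
    \<Rightarrow> 'o \<Rightarrow> 'm \<Rightarrow> 'o \<Rightarrow> 'm \<Rightarrow> 'o \<Rightarrow> bool" where
  "sequence_iso C X f Y g Z X' f' Y' g' Z' \<longleftrightarrow>
     (\<exists>a b c. is_iso C X a X' \<and> is_iso C Y b Y' \<and> is_iso C Z c Z' \<and>
        b \<cdot>\<^bsub>C\<^esub> f = f' \<cdot>\<^bsub>C\<^esub> a \<and> c \<cdot>\<^bsub>C\<^esub> g = g' \<cdot>\<^bsub>C\<^esub> b)"

definition irreducible_mor :: "('o, 'm, 'k) lin_cat \<Rightarrow> 'o \<Rightarrow> 'm \<Rightarrow> 'o \<Rightarrow> bool" where
  "irreducible_mor C X f Y \<longleftrightarrow> f \<in> mor C X Y \<and>
     \<not> is_section C X f Y \<and> \<not> is_retraction C X f Y \<and>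
     (\<forall>W. \<forall>g\<in>mor C X W. \<forall>h\<in>mor C W Y. f = h \<cdot>\<^bsub>C\<^esub> g
        \<longrightarrow> is_retraction C W h Y \<or> is_section C X g W)"

text \<open>\<open>AR_sequence_biproduct C X f\<^sub>1 f\<^sub>2 Y\<^sub>1 Y\<^sub>2 g\<^sub>1 g\<^sub>2 Z\<close> says that the column
  \<open>(f\<^sub>1, f\<^sub>2) : X \<rightarrow> Y\<^sub>1 \<oplus> Y\<^sub>2\<close> and the row \<open>(g\<^sub>1, g\<^sub>2) : Y\<^sub>1 \<oplus> Y\<^sub>2 \<rightarrow> Z\<close> form an
  Auslander-Reiten sequence, where \<open>Y\<^sub>1 \<oplus> Y\<^sub>2\<close> is some direct sum \<open>W\<close> of \<open>Y\<^sub>1\<close> and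
  \<open>Y\<^sub>2\<close>; direct sums are unique up to an isomorphism compatible with the
  injections and projections, so the choice is immaterial.\<close>

definition AR_sequence_biproduct :: "('o, 'm, 'k) lin_cat \<Rightarrow> 'o \<Rightarrow> 'm \<Rightarrow> 'm \<Rightarrow> 'o \<Rightarrow> 'o
    \<Rightarrow> 'm \<Rightarrow> 'm \<Rightarrow> 'o \<Rightarrow> bool" where
  "AR_sequence_biproduct C X f\<^sub>1 f\<^sub>2 Y\<^sub>1 Y\<^sub>2 g\<^sub>1 g\<^sub>2 Z \<longleftrightarrow>
     f\<^sub>1 \<in> mor C X Y\<^sub>1 \<and> f\<^sub>2 \<in> mor C X Y\<^sub>2 \<and> g\<^sub>1 \<in> mor C Y\<^sub>1 Z \<and> g\<^sub>2 \<in> mor C Y\<^sub>2 Z \<and>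
     (\<exists>W i\<^sub>1 i\<^sub>2 p\<^sub>1 p\<^sub>2. biproduct C Y\<^sub>1 Y\<^sub>2 W i\<^sub>1 i\<^sub>2 p\<^sub>1 p\<^sub>2 \<and>
        AR_sequence C X (i\<^sub>1 \<cdot>\<^bsub>C\<^esub> f\<^sub>1 \<oplus>\<^bsub>Hom C X W\<^esub> i\<^sub>2 \<cdot>\<^bsub>C\<^esub> f\<^sub>2)
          W (g\<^sub>1 \<cdot>\<^bsub>C\<^esub> p\<^sub>1 \<oplus>\<^bsub>Hom C W Z\<^esub> g\<^sub>2 \<cdot>\<^bsub>C\<^esub> p\<^sub>2) Z)"

end

theory Submission
  imports Defs
begin

text \<open>
  Uniqueness rests on the end terms being local objects. A right almost
  split morphism makes its codomain an object with local endomorphism ring, since the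
  non-retractions among the endomorphisms are those factoring through it, and these are
  closed under addition; the dual holds for domains. Given two sequences that start at \<open>X\<close>,
  minimality of the left-hand morphisms gives an isomorphism of the middle terms, and the
  weak cokernel property extends it to morphisms \<open>c : Z \<rightarrow> Z'\<close> and \<open>c' : Z' \<rightarrow> Z\<close> with
  \<open>c'cg = g\<close> and \<open>cc'g' = g'\<close>. By locality, \<open>c'c\<close> or \<open>1 - c'c\<close> is invertible, and the latter would
  force \<open>g = 0\<close>. This is where \<open>Y \<noteq> 0\<close> enters: if \<open>g = 0\<close>, then \<open>id\<^sub>Y\<close> factors through the weak kernel \<open>f\<close>
  of \<open>g\<close>, so \<open>Y\<close> is a nonzero retract of the local object \<open>X\<close> and \<open>f\<close> is invertible, which no
  left almost split morphism is. The statement about sequences that end at \<open>Z\<close> follows by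
  passing to the opposite category.

  For the second part, an irreducible \<open>f\<^sub>1 : X \<rightarrow> Y\<^sub>1\<close> factors as \<open>hf\<close> because \<open>f\<close> is left almost
  split, and \<open>h : Y \<rightarrow> Y\<^sub>1\<close> must be a retraction because \<open>f\<close> is not a section. If \<open>Y\<close> is a direct
  sum \<open>Y\<^sub>1 \<oplus> Y\<^sub>2\<close> whose first projection is \<open>h\<close>, then reading \<open>f\<close> and \<open>g\<close> in
  components gives the required sequence; \<open>g\<^sub>1\<close> is treated in the same way. So the real content is
  that in a Krull-Schmidt category every section, together with any chosen retraction of it, belongs
  to a direct sum decomposition (lemma \<open>all_complemented\<close>). Objects with this
  property are closed under isomorphisms and direct sums, and for local objects it is the
  classical exchange argument: in a decomposition of the ambient object into local summands, the
  given local object can replace one of the summands.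
\<close>

section \<open>Calculus of morphisms\<close>

context linear_category
begin

abbreviation comp (infixl "\<bullet>" 75) where
  "g \<bullet> f \<equiv> g \<cdot>\<^bsub>C\<^esub> f"

lemma mor_Obj:
  assumes "f \<in> mor C X Y"
  shows "X \<in> Obj C" and "Y \<in> Obj C"
  using assms by (auto simp: mor_def)

lemma mor_carrier: "f \<in> mor C X Y \<Longrightarrow> f \<in> carrier (Hom C X Y)"
  by (simp add: mor_def)

lemma mor_iff: "\<lbrakk>X \<in> Obj C; Y \<in> Obj C\<rbrakk> \<Longrightarrow> mor C X Y = carrier (Hom C X Y)"
  by (auto simp: mor_def)

lemma Hom_abelian_group: "\<lbrakk>X \<in> Obj C; Y \<in> Obj C\<rbrakk> \<Longrightarrow> abelian_group (Hom C X Y)"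
  using hom_module by (simp add: module_def)

lemma zero_mor: "\<lbrakk>X \<in> Obj C; Y \<in> Obj C\<rbrakk> \<Longrightarrow> \<zero>\<^bsub>Hom C X Y\<^esub> \<in> mor C X Y"
  by (simp add: mor_iff abelian_group.axioms(1) abelian_monoid.zero_closed Hom_abelian_group)

lemma add_mor: "\<lbrakk>f \<in> mor C X Y; g \<in> mor C X Y\<rbrakk> \<Longrightarrow> f \<oplus>\<^bsub>Hom C X Y\<^esub> g \<in> mor C X Y"
  using Hom_abelian_group[of X Y]
  by (auto simp: mor_def abelian_group_def intro: abelian_monoid.a_closed)

lemma add_zero_left: "f \<in> mor C X Y \<Longrightarrow> \<zero>\<^bsub>Hom C X Y\<^esub> \<oplus>\<^bsub>Hom C X Y\<^esub> f = f"
  using Hom_abelian_group[of X Y]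
  by (auto simp: mor_def abelian_group_def intro: abelian_monoid.l_zero)

lemma add_commute:
  "\<lbrakk>f \<in> mor C X Y; g \<in> mor C X Y\<rbrakk> \<Longrightarrow> f \<oplus>\<^bsub>Hom C X Y\<^esub> g = g \<oplus>\<^bsub>Hom C X Y\<^esub> f"
  using Hom_abelian_group[of X Y]
  by (auto simp: mor_def abelian_group_def intro: abelian_monoid.a_comm)

lemma add_zero_right: "f \<in> mor C X Y \<Longrightarrow> f \<oplus>\<^bsub>Hom C X Y\<^esub> \<zero>\<^bsub>Hom C X Y\<^esub> = f"
  by (metis add_commute add_zero_left mor_Obj zero_mor)

lemma add_assoc:
  "\<lbrakk>f \<in> mor C X Y; g \<in> mor C X Y; h \<in> mor C X Y\<rbrakk>
    \<Longrightarrow> f \<oplus>\<^bsub>Hom C X Y\<^esub> g \<oplus>\<^bsub>Hom C X Y\<^esub> h = f \<oplus>\<^bsub>Hom C X Y\<^esub> (g \<oplus>\<^bsub>Hom C X Y\<^esub> h)"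
  using Hom_abelian_group[of X Y]
  by (auto simp: mor_def abelian_group_def intro: abelian_monoid.a_assoc)

lemma add_cancel:
  assumes "f \<in> mor C X Y" "g \<in> mor C X Y" "h \<in> mor C X Y"
    and "f \<oplus>\<^bsub>Hom C X Y\<^esub> h = g \<oplus>\<^bsub>Hom C X Y\<^esub> h"
  shows "f = g"
proof -
  interpret abelian_group "Hom C X Y"
    using assms mor_Obj Hom_abelian_group by blast
  show ?thesis
    using assms mor_carrier by (metis add.right_cancel)
qed

lemma difference_exists:
  assumes "f \<in> mor C X Y" "h \<in> mor C X Y"
  shows "\<exists>d\<in>mor C X Y. d \<oplus>\<^bsub>Hom C X Y\<^esub> h = f"
proof -
  interpret abelian_group "Hom C X Y"
    using assms mor_Obj Hom_abelian_group by blast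
  have c: "f \<in> carrier (Hom C X Y)" "h \<in> carrier (Hom C X Y)"
    using assms mor_carrier by auto
  then have "(f \<ominus>\<^bsub>Hom C X Y\<^esub> h) \<oplus>\<^bsub>Hom C X Y\<^esub> h = f"
    by (simp add: a_minus_def a_assoc l_neg)
  moreover have "f \<ominus>\<^bsub>Hom C X Y\<^esub> h \<in> mor C X Y"
    using c assms by (simp add: mor_def)
  ultimately show ?thesis by blast
qed

lemma add_eq_self_iff:
  assumes "f \<in> mor C X Y" "h \<in> mor C X Y"
  shows "f \<oplus>\<^bsub>Hom C X Y\<^esub> h = h \<longleftrightarrow> f = \<zero>\<^bsub>Hom C X Y\<^esub>"
  using assms add_cancel[of f X Y "\<zero>\<^bsub>Hom C X Y\<^esub>" h] add_zero_left mor_Obj zero_mor by metis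

lemma cmp_zero_left:
  assumes "f \<in> mor C X Y" "Z \<in> Obj C"
  shows "\<zero>\<^bsub>Hom C Y Z\<^esub> \<bullet> f = \<zero>\<^bsub>Hom C X Z\<^esub>"
proof -
  have z: "\<zero>\<^bsub>Hom C Y Z\<^esub> \<in> mor C Y Z" using assms mor_Obj zero_mor by blast
  then have "\<zero>\<^bsub>Hom C Y Z\<^esub> \<bullet> f \<oplus>\<^bsub>Hom C X Z\<^esub> \<zero>\<^bsub>Hom C Y Z\<^esub> \<bullet> f = \<zero>\<^bsub>Hom C Y Z\<^esub> \<bullet> f"
    using cmp_add_left[OF assms(1) z z] add_zero_left[OF z] by simp
  then show ?thesis using add_eq_self_iff cmp_mor[OF assms(1) z] by blast
qed

lemma cmp_zero_right:
  assumes "g \<in> mor C Y Z" "X \<in> Obj C"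
  shows "g \<bullet> \<zero>\<^bsub>Hom C X Y\<^esub> = \<zero>\<^bsub>Hom C X Z\<^esub>"
proof -
  have z: "\<zero>\<^bsub>Hom C X Y\<^esub> \<in> mor C X Y" using assms mor_Obj zero_mor by blast
  then have "g \<bullet> \<zero>\<^bsub>Hom C X Y\<^esub> \<oplus>\<^bsub>Hom C X Z\<^esub> g \<bullet> \<zero>\<^bsub>Hom C X Y\<^esub> = g \<bullet> \<zero>\<^bsub>Hom C X Y\<^esub>"
    using cmp_add_right[OF z z assms(1)] add_zero_left[OF z] by simp
  then show ?thesis using add_eq_self_iff cmp_mor[OF z assms(1)] by blast
qed

lemma zero_object_iff: "zero_object C N \<longleftrightarrow> N \<in> Obj C \<and> idm C N = \<zero>\<^bsub>Hom C N N\<^esub>"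
proof
  assume "zero_object C N"
  then have N: "N \<in> Obj C" and "\<exists>!f. f \<in> mor C N N" by (auto simp: zero_object_def)
  then show "N \<in> Obj C \<and> idm C N = \<zero>\<^bsub>Hom C N N\<^esub>" using id_mor zero_mor by blast
next
  assume N: "N \<in> Obj C \<and> idm C N = \<zero>\<^bsub>Hom C N N\<^esub>"
  have "f = \<zero>\<^bsub>Hom C X N\<^esub>" if "f \<in> mor C X N" for X f
    using that N cmp_zero_left id_left by metis
  moreover have "f = \<zero>\<^bsub>Hom C N X\<^esub>" if "f \<in> mor C N X" for X f
    using that N cmp_zero_right id_right by metis
  ultimately show "zero_object C N"
    unfolding zero_object_def using N zero_mor by metis
qed

lemma is_iso_cmp:
  assumes "is_iso C X f Y" "is_iso C Y g Z"
  shows "is_iso C X (g \<bullet> f) Z"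
proof -
  obtain f' where f: "f \<in> mor C X Y" "f' \<in> mor C Y X" "f' \<bullet> f = idm C X" "f \<bullet> f' = idm C Y"
    using assms(1) by (auto simp: is_iso_def)
  obtain g' where g: "g \<in> mor C Y Z" "g' \<in> mor C Z Y" "g' \<bullet> g = idm C Y" "g \<bullet> g' = idm C Z"
    using assms(2) by (auto simp: is_iso_def)
  have gf: "g \<bullet> f \<in> mor C X Z" and fg: "f' \<bullet> g' \<in> mor C Z X" using f g cmp_mor by blast+
  have "(f' \<bullet> g') \<bullet> (g \<bullet> f) = idm C X"
    using cmp_assoc[OF gf g(2) f(2)] cmp_assoc[OF f(1) g(1,2)] f g id_left[OF f(1)] by simp
  moreover have "(g \<bullet> f) \<bullet> (f' \<bullet> g') = idm C Z"
    using cmp_assoc[OF fg f(1) g(1)] cmp_assoc[OF g(2) f(2,1)] f g id_left[OF g(2)] by simp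
  ultimately show ?thesis using gf fg by (auto simp: is_iso_def)
qed

lemma is_isoI_cmp:
  assumes f: "f \<in> mor C X Y" and g: "g \<in> mor C Y X"
    and "is_iso C X (g \<bullet> f) X" "is_iso C Y (f \<bullet> g) Y"
  shows "is_iso C X f Y"
proof -
  obtain x where x: "x \<in> mor C X X" "x \<bullet> (g \<bullet> f) = idm C X"
    using assms(3) by (auto simp: is_iso_def)
  obtain y where y: "y \<in> mor C Y Y" "(f \<bullet> g) \<bullet> y = idm C Y"
    using assms(4) by (auto simp: is_iso_def)
  have xg: "x \<bullet> g \<in> mor C Y X" and gy: "g \<bullet> y \<in> mor C Y X" using f g x y cmp_mor by blast+
  have l: "(x \<bullet> g) \<bullet> f = idm C X" using cmp_assoc[OF f g x(1)] x by simp
  have r: "f \<bullet> (g \<bullet> y) = idm C Y" using cmp_assoc[OF y(1) g f] y by simp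
  have "x \<bullet> g = (x \<bullet> g) \<bullet> (f \<bullet> (g \<bullet> y))" using r id_right[OF xg] by simp
  also have "\<dots> = g \<bullet> y" using l cmp_assoc[OF gy f xg] id_left[OF gy] by simp
  finally show ?thesis using l r f xg unfolding is_iso_def by metis
qed

lemma inverse_square:
  assumes f: "f \<in> mor C X Y" and f': "f' \<in> mor C X' Y'"
    and a: "a \<in> mor C X X'" "a' \<in> mor C X' X" "a \<bullet> a' = idm C X'"
    and b: "b \<in> mor C Y Y'" "b' \<in> mor C Y' Y" "b' \<bullet> b = idm C Y"
    and sq: "b \<bullet> f = f' \<bullet> a"
  shows "b' \<bullet> f' = f \<bullet> a'"
proof -
  have fa': "f \<bullet> a' \<in> mor C X' Y" using f a cmp_mor by blast
  have "b \<bullet> (f \<bullet> a') = f'"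
    using cmp_assoc[OF a(2) f b(1)] cmp_assoc[OF a(2,1) f'] sq a(3) id_right[OF f'] by simp
  then show ?thesis using cmp_assoc[OF fa' b(1,2)] b(3) id_left[OF fa'] by simp
qed

lemma sequence_iso_sym:
  assumes "sequence_iso C X f Y g Z X' f' Y' g' Z'"
    and f: "f \<in> mor C X Y" and g: "g \<in> mor C Y Z"
    and f': "f' \<in> mor C X' Y'" and g': "g' \<in> mor C Y' Z'"
  shows "sequence_iso C X' f' Y' g' Z' X f Y g Z"
proof -
  obtain a b c where "is_iso C X a X'" "is_iso C Y b Y'" "is_iso C Z c Z'"
    and sq: "b \<bullet> f = f' \<bullet> a" "c \<bullet> g = g' \<bullet> b"
    using assms(1) by (auto simp: sequence_iso_def)
  then obtain a' b' c' where
      a: "a \<in> mor C X X'" "a' \<in> mor C X' X" "a' \<bullet> a = idm C X" "a \<bullet> a' = idm C X'"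
    and b: "b \<in> mor C Y Y'" "b' \<in> mor C Y' Y" "b' \<bullet> b = idm C Y" "b \<bullet> b' = idm C Y'"
    and c: "c \<in> mor C Z Z'" "c' \<in> mor C Z' Z" "c' \<bullet> c = idm C Z" "c \<bullet> c' = idm C Z'"
    unfolding is_iso_def by metis
  have "b' \<bullet> f' = f \<bullet> a'" using inverse_square[OF f f' a(1,2,4) b(1,2,3) sq(1)] .
  moreover have "c' \<bullet> g' = g \<bullet> b'" using inverse_square[OF g g' b(1,2,4) c(1,2,3) sq(2)] .
  ultimately show ?thesis unfolding sequence_iso_def is_iso_def using a b c by metis
qed

end

section \<open>The opposite category\<close>

text \<open>
  The Hom-modules are reused unchanged, so sums and zero morphisms in the opposite category are
  literally those of the original one, and every notion turns into its dual by rewriting.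
\<close>

definition opposite :: "('o, 'm, 'k) lin_cat \<Rightarrow> ('o, 'm, 'k) lin_cat" where
  "opposite C = \<lparr>Obj = Obj C, Hom = (\<lambda>X Y. Hom C Y X), cmp = (\<lambda>g f. f \<cdot>\<^bsub>C\<^esub> g), idm = idm C\<rparr>"

lemma opposite_simps [simp]:
  "Obj (opposite C) = Obj C" "Hom (opposite C) X Y = Hom C Y X"
  "cmp (opposite C) g f = f \<cdot>\<^bsub>C\<^esub> g" "idm (opposite C) = idm C"
  "mor (opposite C) X Y = mor C Y X"
  by (auto simp: opposite_def mor_def)

lemma opposite_predicates [simp]:
  "is_section (opposite C) X f Y = is_retraction C Y f X"
  "is_retraction (opposite C) X f Y = is_section C Y f X"
  "is_iso (opposite C) X f Y = is_iso C Y f X"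
  "zero_object (opposite C) N = zero_object C N"
  "left_almost_split (opposite C) X f Y = right_almost_split C Y f X"
  "right_almost_split (opposite C) X f Y = left_almost_split C Y f X"
  "left_minimal (opposite C) X f Y = right_minimal C Y f X"
  "right_minimal (opposite C) X f Y = left_minimal C Y f X"
  by (auto simp: is_section_def is_retraction_def is_iso_def zero_object_def left_almost_split_def
      right_almost_split_def left_minimal_def right_minimal_def)

lemma opposite_AR_sequence [simp]:
  "AR_sequence (opposite C) Z g Y f X = AR_sequence C X f Y g Z"
  by (auto simp: AR_sequence_def weak_kernel_def weak_cokernel_def minimal_left_almost_split_def
      minimal_right_almost_split_def)

lemma opposite_sequence_iso [simp]:
  "sequence_iso (opposite C) Z g Y f X Z' g' Y' f' X' = sequence_iso C X' f' Y' g' Z' X f Y g Z"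
  unfolding sequence_iso_def opposite_simps opposite_predicates by metis

lemma opposite_biproduct [simp]:
  "biproduct (opposite C) X Y W i\<^sub>1 i\<^sub>2 p\<^sub>1 p\<^sub>2 = biproduct C X Y W p\<^sub>1 p\<^sub>2 i\<^sub>1 i\<^sub>2"
  by (auto simp: biproduct_def)

lemma (in linear_category) linear_category_opposite: "linear_category K (opposite C)"
  by (rule linear_category.intro[OF is_cring linear_category_axioms.intro];
      unfold opposite_simps;
      (rule hom_module id_mor cmp_mor cmp_assoc[symmetric] id_left id_right cmp_add_left
        cmp_add_right cmp_smult_left cmp_smult_right; assumption))

section \<open>Local objects\<close>

text \<open>
  This says that the endomorphism ring is local, phrased so as to avoid forming that ring: of two
  endomorphisms summing to the identity, one is an isomorphism. In this form the notion is visibly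
  self-dual, and it is what the arguments below consume.
\<close>

definition local_object :: "('o, 'm, 'k) lin_cat \<Rightarrow> 'o \<Rightarrow> bool" where
  "local_object C L \<longleftrightarrow> L \<in> Obj C \<and> idm C L \<noteq> \<zero>\<^bsub>Hom C L L\<^esub> \<and>
     (\<forall>s\<in>mor C L L. \<forall>t\<in>mor C L L. s \<oplus>\<^bsub>Hom C L L\<^esub> t = idm C L \<longrightarrow>
        is_iso C L s L \<or> is_iso C L t L)"

lemma opposite_local_object [simp]: "local_object (opposite C) L = local_object C L"
  by (auto simp: local_object_def)

context linear_category
begin

lemma local_object_if_local_ring:
  assumes X: "X \<in> Obj C" and "local_ring (end_ring C X)"
  shows "local_object C X"
proof -
  interpret E: local_ring "end_ring C X" by fact
  have unit: "is_iso C X s X" if "s \<in> Units (end_ring C X)" for s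
    using that by (auto simp: Units_def end_ring_def is_iso_def)
  have "is_iso C X s X \<or> is_iso C X t X"
    if st: "s \<in> mor C X X" "t \<in> mor C X X" "s \<oplus>\<^bsub>Hom C X X\<^esub> t = idm C X" for s t
  proof (rule ccontr)
    assume "\<not> (is_iso C X s X \<or> is_iso C X t X)"
    then have "s \<in> carrier (end_ring C X) - Units (end_ring C X)"
      "t \<in> carrier (end_ring C X) - Units (end_ring C X)"
      using st unit by (auto simp: end_ring_def)
    from E.nonunits_add[OF this] st(3) have "idm C X \<notin> Units (end_ring C X)"
      by (simp add: end_ring_def)
    then show False using E.Units_one_closed by (simp add: end_ring_def)
  qed
  moreover have "idm C X \<noteq> \<zero>\<^bsub>Hom C X X\<^esub>"
    using E.nontrivial by (simp add: end_ring_def)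
  ultimately show ?thesis using X by (auto simp: local_object_def)
qed

text \<open>
  Composing with the inverse of the sum reduces to summands of the identity.
\<close>

lemma local_object_sum_iso:
  assumes L: "local_object C L" and s: "s \<in> mor C L L" and t: "t \<in> mor C L L"
    and "is_iso C L (s \<oplus>\<^bsub>Hom C L L\<^esub> t) L"
  shows "is_iso C L s L \<or> is_iso C L t L"
proof -
  have st: "s \<oplus>\<^bsub>Hom C L L\<^esub> t \<in> mor C L L" using add_mor s t by blast
  obtain w where w: "w \<in> mor C L L" "w \<bullet> (s \<oplus>\<^bsub>Hom C L L\<^esub> t) = idm C L"
    and w': "(s \<oplus>\<^bsub>Hom C L L\<^esub> t) \<bullet> w = idm C L"
    using assms(4) by (auto simp: is_iso_def)
  have iso_st: "is_iso C L (s \<oplus>\<^bsub>Hom C L L\<^esub> t) L" by fact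
  have cancel: "is_iso C L x L" if x: "x \<in> mor C L L" and wx: "is_iso C L (w \<bullet> x) L" for x
  proof -
    have "(s \<oplus>\<^bsub>Hom C L L\<^esub> t) \<bullet> (w \<bullet> x) = x"
      using cmp_assoc[OF x w(1) st] w' id_left[OF x] by simp
    then show ?thesis using is_iso_cmp[OF wx iso_st] by simp
  qed
  have "w \<bullet> s \<oplus>\<^bsub>Hom C L L\<^esub> w \<bullet> t = idm C L"
    using cmp_add_right[OF s t w(1)] w(2) by simp
  then have "is_iso C L (w \<bullet> s) L \<or> is_iso C L (w \<bullet> t) L"
    using L cmp_mor s t w(1) unfolding local_object_def by blast
  then show ?thesis using cancel s t by blast
qed

text \<open>
  The endomorphisms \<open>e\<close> and \<open>1 - e\<close> sum to the identity and \<open>e(1 - e) = 0\<close>; cancel whichever of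
  the two is invertible.
\<close>

lemma local_object_idempotent:
  assumes L: "local_object C L" and e: "e \<in> mor C L L" "e \<bullet> e = e"
  shows "e = \<zero>\<^bsub>Hom C L L\<^esub> \<or> e = idm C L"
proof -
  have LO: "L \<in> Obj C" using L by (simp add: local_object_def)
  obtain d where d: "d \<in> mor C L L" "d \<oplus>\<^bsub>Hom C L L\<^esub> e = idm C L"
    using difference_exists id_mor LO e by blast
  have "e \<bullet> d \<oplus>\<^bsub>Hom C L L\<^esub> e = e"
    using cmp_add_right[OF d(1) e(1) e(1)] e d id_right[OF e(1)] by simp
  then have ed: "e \<bullet> d = \<zero>\<^bsub>Hom C L L\<^esub>"
    using add_eq_self_iff cmp_mor d e by blast
  consider "is_iso C L e L" | "is_iso C L d L"
    using L d e unfolding local_object_def by blast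
  then show ?thesis
  proof cases
    case 1
    then obtain w where w: "w \<in> mor C L L" "w \<bullet> e = idm C L" by (auto simp: is_iso_def)
    then have "e = idm C L" using cmp_assoc[OF e(1,1) w(1)] e id_left[OF e(1)] by simp
    then show ?thesis ..
  next
    case 2
    then obtain w where w: "w \<in> mor C L L" "d \<bullet> w = idm C L" by (auto simp: is_iso_def)
    then have "e = \<zero>\<^bsub>Hom C L L\<^esub>"
      using e d ed cmp_assoc[OF w(1) d(1) e(1)] cmp_zero_left[OF w(1) LO] id_right by simp
    then show ?thesis ..
  qed
qed

text \<open>
  A local object has no proper nonzero retracts: \<open>uv\<close> is an idempotent of \<open>M\<close>, and \<open>uv = 0\<close> would give
  \<open>u = uvu = 0\<close>.
\<close>

lemma section_into_local_object:
  assumes M: "local_object C M" and L: "idm C L \<noteq> \<zero>\<^bsub>Hom C L L\<^esub>"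
    and u: "u \<in> mor C L M" and v: "v \<in> mor C M L" and vu: "v \<bullet> u = idm C L"
  shows "u \<bullet> v = idm C M"
proof -
  have uv: "u \<bullet> v \<in> mor C M M" using u v cmp_mor by blast
  have LO: "L \<in> Obj C" and MO: "M \<in> Obj C" using u mor_Obj by blast+
  have uvu: "u \<bullet> v \<bullet> u = u" using cmp_assoc[OF u v u] vu id_right[OF u] by simp
  have "(u \<bullet> v) \<bullet> (u \<bullet> v) = u \<bullet> v"
    using cmp_assoc[OF v u uv] uvu by simp
  moreover have "u \<bullet> v \<noteq> \<zero>\<^bsub>Hom C M M\<^esub>"
  proof
    assume "u \<bullet> v = \<zero>\<^bsub>Hom C M M\<^esub>"
    then have "u = \<zero>\<^bsub>Hom C L M\<^esub>" using uvu cmp_zero_left[OF u MO] by simp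
    then show False using vu L cmp_zero_right[OF v LO] by simp
  qed
  ultimately show ?thesis using local_object_idempotent[OF M uv] by blast
qed

text \<open>
  Two non-retractions factor through \<open>g\<close>, hence so does their sum, and the identity does not factor
  through \<open>g\<close>. So one of two summands of the identity is a retraction. To see that a
  retraction \<open>t\<close> with \<open>tr = 1\<close> is invertible, apply this to the idempotents \<open>rt\<close> and
  \<open>d = 1 - rt\<close>: an idempotent retraction is the identity, and \<open>d = 1\<close> would make \<open>rt\<close> and then \<open>r\<close> zero.
\<close>

lemma local_object_if_right_almost_split:
  assumes g: "right_almost_split C Y g Z"
  shows "local_object C Z"
proof -
  have gm: "g \<in> mor C Y Z" and nr: "\<not> is_retraction C Y g Z"
    and lift: "\<And>t. t \<in> mor C Z Z \<Longrightarrow> \<not> is_retraction C Z t Z \<Longrightarrow> \<exists>a\<in>mor C Z Y. t = g \<bullet> a"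
    using g by (auto simp: right_almost_split_def)
  have Z: "Z \<in> Obj C" and Y: "Y \<in> Obj C" using gm mor_Obj by blast+
  have id_ne: "idm C Z \<noteq> \<zero>\<^bsub>Hom C Z Z\<^esub>"
    using nr gm cmp_zero_right[OF gm Z] zero_mor[OF Z Y] by (metis is_retraction_def)
  have retr: "is_retraction C Z s Z \<or> is_retraction C Z t Z"
    if st: "s \<in> mor C Z Z" "t \<in> mor C Z Z" "s \<oplus>\<^bsub>Hom C Z Z\<^esub> t = idm C Z" for s t
  proof (rule ccontr)
    assume "\<not> (is_retraction C Z s Z \<or> is_retraction C Z t Z)"
    then obtain a b where ab: "a \<in> mor C Z Y" "b \<in> mor C Z Y" "s = g \<bullet> a" "t = g \<bullet> b"
      using lift st by metis
    then have "g \<bullet> (a \<oplus>\<^bsub>Hom C Z Y\<^esub> b) = idm C Z"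
      using cmp_add_right[OF ab(1,2) gm] st(3) by simp
    then show False using nr gm add_mor[OF ab(1,2)] by (auto simp: is_retraction_def)
  qed
  have idem: "e = idm C Z"
    if e: "e \<in> mor C Z Z" "e \<bullet> e = e" "is_retraction C Z e Z" for e
  proof -
    obtain x where x: "x \<in> mor C Z Z" "e \<bullet> x = idm C Z" using e by (auto simp: is_retraction_def)
    then show ?thesis using cmp_assoc[OF x(1) e(1,1)] e(2) id_right[OF e(1)] by simp
  qed
  have iso: "is_iso C Z t Z" if t: "is_retraction C Z t Z" for t
  proof -
    obtain r where tm: "t \<in> mor C Z Z" and r: "r \<in> mor C Z Z" "t \<bullet> r = idm C Z"
      using t by (auto simp: is_retraction_def)
    have rt: "r \<bullet> t \<in> mor C Z Z" using r tm cmp_mor by blast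
    have rtr: "r \<bullet> t \<bullet> r = r" using cmp_assoc[OF r(1) tm r(1)] r id_right[OF r(1)] by simp
    have rtrt: "(r \<bullet> t) \<bullet> (r \<bullet> t) = r \<bullet> t" using cmp_assoc[OF tm r(1) rt] rtr by simp
    obtain d where d: "d \<in> mor C Z Z" "d \<oplus>\<^bsub>Hom C Z Z\<^esub> r \<bullet> t = idm C Z"
      using difference_exists id_mor Z rt by blast
    have "d \<bullet> (r \<bullet> t) \<oplus>\<^bsub>Hom C Z Z\<^esub> r \<bullet> t = r \<bullet> t"
      using cmp_add_left[OF rt d(1) rt] rtrt d(2) id_left[OF rt] by simp
    then have drt: "d \<bullet> (r \<bullet> t) = \<zero>\<^bsub>Hom C Z Z\<^esub>"
      using add_eq_self_iff cmp_mor d rt by blast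
    have "d \<bullet> d \<oplus>\<^bsub>Hom C Z Z\<^esub> d \<bullet> (r \<bullet> t) = d"
      using cmp_add_right[OF d(1) rt d(1)] d id_right by simp
    then have dd: "d \<bullet> d = d" using drt add_zero_right cmp_mor d by metis
    have "\<not> is_retraction C Z d Z"
    proof
      assume "is_retraction C Z d Z"
      then have "d = idm C Z" using idem d dd by blast
      then have "r \<bullet> t = \<zero>\<^bsub>Hom C Z Z\<^esub>" using drt id_left[OF rt] by simp
      then have "r = \<zero>\<^bsub>Hom C Z Z\<^esub>" using rtr cmp_zero_left[OF r(1) Z] by simp
      then show False using r id_ne cmp_zero_right[OF tm Z] by simp
    qed
    then have "r \<bullet> t = idm C Z" using retr[OF d(1) rt d(2)] idem rt rtrt by blast
    then show ?thesis using r tm by (auto simp: is_iso_def)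
  qed
  show ?thesis unfolding local_object_def using Z id_ne retr iso by blast
qed

lemma local_object_if_left_almost_split:
  assumes "left_almost_split C X f Y"
  shows "local_object C X"
  using linear_category.local_object_if_right_almost_split[OF linear_category_opposite, of Y f X]
    assms by simp


section \<open>Uniqueness of Auslander-Reiten sequences\<close>

lemma AR_sequence_local:
  assumes "AR_sequence C X f Y g Z"
  shows "local_object C X" and "local_object C Z"
  using assms local_object_if_left_almost_split local_object_if_right_almost_split
  by (auto simp: AR_sequence_def minimal_left_almost_split_def minimal_right_almost_split_def)

lemma AR_sequence_mor:
  assumes "AR_sequence C X f Y g Z"
  shows "f \<in> mor C X Y" and "g \<in> mor C Y Z" and "g \<bullet> f = \<zero>\<^bsub>Hom C X Z\<^esub>"
  using assms by (auto simp: AR_sequence_def weak_kernel_def)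

text \<open>
  For \<open>g = 0\<close> the weak kernel \<open>f\<close> of \<open>g\<close> is a retraction onto \<open>Y \<noteq> 0\<close>; since \<open>X\<close> is local, \<open>f\<close> would then
  be an isomorphism, in particular a section.
\<close>

lemma AR_sequence_right_nonzero:
  assumes AR: "AR_sequence C X f Y g Z" and Y: "\<not> zero_object C Y"
  shows "g \<noteq> \<zero>\<^bsub>Hom C Y Z\<^esub>"
proof
  assume g: "g = \<zero>\<^bsub>Hom C Y Z\<^esub>"
  note f = AR_sequence_mor(1)[OF AR] and gm = AR_sequence_mor(2)[OF AR]
  have YO: "Y \<in> Obj C" and Z: "Z \<in> Obj C" using gm mor_Obj by blast+
  have id: "idm C Y \<in> mor C Y Y" using YO id_mor by blast
  have "g \<bullet> idm C Y = \<zero>\<^bsub>Hom C Y Z\<^esub>" using g cmp_zero_left[OF id Z] by simp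
  then obtain s where s: "s \<in> mor C Y X" "idm C Y = f \<bullet> s"
    using AR id unfolding AR_sequence_def weak_kernel_def by blast
  moreover have "idm C Y \<noteq> \<zero>\<^bsub>Hom C Y Y\<^esub>" using Y YO zero_object_iff by blast
  ultimately have "s \<bullet> f = idm C X"
    using section_into_local_object[OF AR_sequence_local(1)[OF AR] _ s(1) f] by metis
  then have "is_section C X f Y" using s f by (auto simp: is_section_def)
  then show False
    using AR by (simp add: AR_sequence_def minimal_left_almost_split_def left_almost_split_def)
qed

text \<open>
  Since \<open>1 - t\<close> kills \<open>g \<noteq> 0\<close>, it is not invertible; locality leaves only \<open>t\<close>.
\<close>

lemma local_object_iso_if_fixes:
  assumes Z: "local_object C Z" and g: "g \<in> mor C Y Z" "g \<noteq> \<zero>\<^bsub>Hom C Y Z\<^esub>"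
    and t: "t \<in> mor C Z Z" "t \<bullet> g = g"
  shows "is_iso C Z t Z"
proof -
  have ZO: "Z \<in> Obj C" and Y: "Y \<in> Obj C" using g mor_Obj by blast+
  obtain d where d: "d \<in> mor C Z Z" "d \<oplus>\<^bsub>Hom C Z Z\<^esub> t = idm C Z"
    using difference_exists id_mor ZO t by blast
  have "d \<bullet> g \<oplus>\<^bsub>Hom C Y Z\<^esub> g = g"
    using cmp_add_left[OF g(1) d(1) t(1)] d t id_left[OF g(1)] by simp
  then have dg: "d \<bullet> g = \<zero>\<^bsub>Hom C Y Z\<^esub>" using add_eq_self_iff cmp_mor d g by blast
  have "\<not> is_iso C Z d Z"
  proof
    assume "is_iso C Z d Z"
    then obtain w where w: "w \<in> mor C Z Z" "w \<bullet> d = idm C Z" by (auto simp: is_iso_def)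
    then have "g = w \<bullet> (d \<bullet> g)" using cmp_assoc[OF g(1) d(1) w(1)] id_left[OF g(1)] by simp
    then show False using dg g cmp_zero_right[OF w(1) Y] by simp
  qed
  then show ?thesis using Z d t unfolding local_object_def by blast
qed

lemma minimal_left_almost_split_unique:
  assumes f: "minimal_left_almost_split C X f Y" and f': "minimal_left_almost_split C X f' Y'"
  shows "\<exists>b. is_iso C Y b Y' \<and> b \<bullet> f = f'"
proof -
  have m: "f \<in> mor C X Y" "f' \<in> mor C X Y'"
    using f f' by (auto simp: minimal_left_almost_split_def left_almost_split_def)
  obtain b where b: "b \<in> mor C Y Y'" "b \<bullet> f = f'"
    using f f' unfolding minimal_left_almost_split_def left_almost_split_def by metis
  obtain b' where b': "b' \<in> mor C Y' Y" "b' \<bullet> f' = f"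
    using f f' unfolding minimal_left_almost_split_def left_almost_split_def by metis
  have "(b' \<bullet> b) \<bullet> f = f" using cmp_assoc[OF m(1) b(1) b'(1)] b b' by simp
  then have 1: "is_iso C Y (b' \<bullet> b) Y"
    using f cmp_mor[OF b(1) b'(1)] by (auto simp: minimal_left_almost_split_def left_minimal_def)
  have "(b \<bullet> b') \<bullet> f' = f'" using cmp_assoc[OF m(2) b'(1) b(1)] b b' by simp
  then have 2: "is_iso C Y' (b \<bullet> b') Y'"
    using f' cmp_mor[OF b'(1) b(1)] by (auto simp: minimal_left_almost_split_def left_minimal_def)
  show ?thesis using is_isoI_cmp[OF b(1) b'(1) 1 2] b by blast
qed

lemma AR_sequence_unique_start:
  assumes AR: "AR_sequence C X f Y g Z" and AR': "AR_sequence C X f' Y' g' Z'"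
    and Y: "\<not> zero_object C Y"
  shows "sequence_iso C X f Y g Z X f' Y' g' Z'"
proof -
  note m = AR_sequence_mor[OF AR] AR_sequence_mor[OF AR']
  obtain b where b: "is_iso C Y b Y'" "b \<bullet> f = f'"
    using minimal_left_almost_split_unique AR AR' unfolding AR_sequence_def by blast
  then obtain b' where bm: "b \<in> mor C Y Y'" and b': "b' \<in> mor C Y' Y" "b' \<bullet> b = idm C Y" "b \<bullet> b' = idm C Y'"
    by (auto simp: is_iso_def)
  have b'f': "b' \<bullet> f' = f" using cmp_assoc[OF m(1) bm b'(1)] b b' id_left[OF m(1)] by simp
  have g'b: "g' \<bullet> b \<in> mor C Y Z'" and gb': "g \<bullet> b' \<in> mor C Y' Z" using m bm b' cmp_mor by blast+
  have "g' \<bullet> b \<bullet> f = \<zero>\<^bsub>Hom C X Z'\<^esub>" using cmp_assoc[OF m(1) bm m(5)] b m by simp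
  then obtain c where c: "c \<in> mor C Z Z'" "g' \<bullet> b = c \<bullet> g"
    using AR g'b unfolding AR_sequence_def weak_cokernel_def by blast
  have "g \<bullet> b' \<bullet> f' = \<zero>\<^bsub>Hom C X Z\<^esub>" using cmp_assoc[OF m(4) b'(1) m(2)] b'f' m by simp
  then obtain c' where c': "c' \<in> mor C Z' Z" "g \<bullet> b' = c' \<bullet> g'"
    using AR' gb' unfolding AR_sequence_def weak_cokernel_def by blast
  have "(c' \<bullet> c) \<bullet> g = c' \<bullet> g' \<bullet> b"
    using cmp_assoc[OF m(2) c(1) c'(1)] cmp_assoc[OF bm m(5) c'(1)] c by simp
  also have "\<dots> = g" using c'(2)[symmetric] cmp_assoc[OF bm b'(1) m(2)] b' id_right m by simp
  finally have 1: "(c' \<bullet> c) \<bullet> g = g" .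
  have "(c \<bullet> c') \<bullet> g' = c \<bullet> g \<bullet> b'"
    using cmp_assoc[OF m(5) c'(1) c(1)] cmp_assoc[OF b'(1) m(2) c(1)] c' by simp
  also have "\<dots> = g'" using c(2)[symmetric] cmp_assoc[OF b'(1) bm m(5)] b' id_right m by simp
  finally have 2: "(c \<bullet> c') \<bullet> g' = g'" .
  have g: "g \<noteq> \<zero>\<^bsub>Hom C Y Z\<^esub>" using AR_sequence_right_nonzero[OF AR Y] .
  have g': "g' \<noteq> \<zero>\<^bsub>Hom C Y' Z'\<^esub>"
  proof
    assume "g' = \<zero>\<^bsub>Hom C Y' Z'\<^esub>"
    then have "g \<bullet> b' = \<zero>\<^bsub>Hom C Y' Z\<^esub>" using c' cmp_zero_right[OF c'(1) mor_Obj(1)[OF m(5)]] by simp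
    then have "g = \<zero>\<^bsub>Hom C Y Z\<^esub>"
      using cmp_assoc[OF bm b'(1) m(2)] b'(2) id_right[OF m(2)]
        cmp_zero_left[OF bm mor_Obj(2)[OF m(2)]] by simp
    then show False using g by simp
  qed
  have "is_iso C Z (c' \<bullet> c) Z"
    using local_object_iso_if_fixes[OF AR_sequence_local(2)[OF AR] m(2) g] 1 c c' cmp_mor by blast
  moreover have "is_iso C Z' (c \<bullet> c') Z'"
    using local_object_iso_if_fixes[OF AR_sequence_local(2)[OF AR'] m(5) g'] 2 c c' cmp_mor by blast
  ultimately have "is_iso C Z c Z'" using is_isoI_cmp c c' by blast
  moreover have "is_iso C X (idm C X) X"
    using id_mor id_left m mor_Obj unfolding is_iso_def by metis
  ultimately show ?thesis
    unfolding sequence_iso_def using b c id_right[OF m(4)] by metis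
qed

lemma AR_sequence_unique_end:
  assumes "AR_sequence C X f Y g Z" and "AR_sequence C X' f' Y' g' Z"
    and "\<not> zero_object C Y"
  shows "sequence_iso C X' f' Y' g' Z X f Y g Z"
  using linear_category.AR_sequence_unique_start[OF linear_category_opposite,
      of Z g Y f X g' Y' f' X'] assms by simp


section \<open>Sections have complements\<close>

lemma biproduct_mor:
  assumes "biproduct C X Y W i\<^sub>1 i\<^sub>2 p\<^sub>1 p\<^sub>2"
  shows "i\<^sub>1 \<in> mor C X W" "i\<^sub>2 \<in> mor C Y W" "p\<^sub>1 \<in> mor C W X" "p\<^sub>2 \<in> mor C W Y"
  using assms by (auto simp: biproduct_def)

lemma biproduct_eqs:
  assumes "biproduct C X Y W i\<^sub>1 i\<^sub>2 p\<^sub>1 p\<^sub>2"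
  shows "p\<^sub>1 \<bullet> i\<^sub>1 = idm C X" "p\<^sub>2 \<bullet> i\<^sub>2 = idm C Y"
    "p\<^sub>2 \<bullet> i\<^sub>1 = \<zero>\<^bsub>Hom C X Y\<^esub>" "p\<^sub>1 \<bullet> i\<^sub>2 = \<zero>\<^bsub>Hom C Y X\<^esub>"
    "i\<^sub>1 \<bullet> p\<^sub>1 \<oplus>\<^bsub>Hom C W W\<^esub> i\<^sub>2 \<bullet> p\<^sub>2 = idm C W"
  using assms by (auto simp: biproduct_def)

lemma biproduct_expand_left:
  assumes B: "biproduct C X Y W i\<^sub>1 i\<^sub>2 p\<^sub>1 p\<^sub>2" and h: "h \<in> mor C W V"
  shows "h \<bullet> i\<^sub>1 \<bullet> p\<^sub>1 \<oplus>\<^bsub>Hom C W V\<^esub> h \<bullet> i\<^sub>2 \<bullet> p\<^sub>2 = h"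
proof -
  note m = biproduct_mor[OF B]
  show ?thesis
    using cmp_add_right[OF cmp_mor[OF m(3,1)] cmp_mor[OF m(4,2)] h] biproduct_eqs(5)[OF B]
      cmp_assoc[OF m(3,1) h] cmp_assoc[OF m(4,2) h] id_right[OF h] by simp
qed

lemma biproduct_expand_right:
  assumes B: "biproduct C X Y W i\<^sub>1 i\<^sub>2 p\<^sub>1 p\<^sub>2" and h: "h \<in> mor C V W"
  shows "i\<^sub>1 \<bullet> (p\<^sub>1 \<bullet> h) \<oplus>\<^bsub>Hom C V W\<^esub> i\<^sub>2 \<bullet> (p\<^sub>2 \<bullet> h) = h"
proof -
  note m = biproduct_mor[OF B]
  show ?thesis
    using cmp_add_left[OF h cmp_mor[OF m(3,1)] cmp_mor[OF m(4,2)]] biproduct_eqs(5)[OF B]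
      cmp_assoc[OF h m(3,1)] cmp_assoc[OF h m(4,2)] id_left[OF h] by simp
qed

lemma biproduct_iso_left:
  assumes B: "biproduct C L D W u i v p"
    and h: "h \<in> mor C M L" "k \<in> mor C L M" "k \<bullet> h = idm C M" "h \<bullet> k = idm C L"
  shows "biproduct C M D W (u \<bullet> h) i (k \<bullet> v) p"
proof -
  note m = biproduct_mor[OF B] and e = biproduct_eqs[OF B]
  have uh: "u \<bullet> h \<in> mor C M W" and kv: "k \<bullet> v \<in> mor C W M" using m h cmp_mor by blast+
  have "(k \<bullet> v) \<bullet> (u \<bullet> h) = idm C M"
    using cmp_assoc[OF uh m(3) h(2)] cmp_assoc[OF h(1) m(1,3)] e(1) h(3) id_left[OF h(1)] by simp
  moreover have "p \<bullet> (u \<bullet> h) = \<zero>\<^bsub>Hom C M D\<^esub>"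
    using cmp_assoc[OF h(1) m(1,4)] e(3) cmp_zero_left[OF h(1) mor_Obj(2)[OF m(4)]] by simp
  moreover have "(k \<bullet> v) \<bullet> i = \<zero>\<^bsub>Hom C D M\<^esub>"
    using cmp_assoc[OF m(2,3) h(2)] e(4) cmp_zero_right[OF h(2) mor_Obj(1)[OF m(2)]] by simp
  moreover have "(u \<bullet> h) \<bullet> (k \<bullet> v) = u \<bullet> v"
    using cmp_assoc[OF kv h(1) m(1)] cmp_assoc[OF m(3) h(2,1)] h(4) id_left[OF m(3)] by simp
  ultimately show ?thesis unfolding biproduct_def using m e uh kv by simp
qed

text \<open>
  The complement can be kept as an object when the retraction of a fixed section changes: it is
  enough to correct its injection to \<open>i' = i - uvi\<close>, which \<open>v\<close> kills and which \<open>p\<close> does not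
  distinguish from \<open>i\<close>.
\<close>

lemma biproduct_change_retraction:
  assumes B: "biproduct C L D W u i v' p" and v: "v \<in> mor C W L" "v \<bullet> u = idm C L"
  shows "\<exists>i'. biproduct C L D W u i' v p"
proof -
  note m = biproduct_mor[OF B] and e = biproduct_eqs[OF B]
  have D: "D \<in> Obj C" using m mor_Obj by blast
  have vi: "v \<bullet> i \<in> mor C D L" using cmp_mor[OF m(2) v(1)] .
  have uvi: "u \<bullet> (v \<bullet> i) \<in> mor C D W" using cmp_mor[OF vi m(1)] .
  have uv: "u \<bullet> v \<in> mor C W W" using cmp_mor[OF v(1) m(1)] .
  obtain i' where i': "i' \<in> mor C D W" "i' \<oplus>\<^bsub>Hom C D W\<^esub> u \<bullet> (v \<bullet> i) = i"
    using difference_exists[OF m(2) uvi] by blast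
  have "v \<bullet> i' \<oplus>\<^bsub>Hom C D L\<^esub> v \<bullet> i = v \<bullet> i"
    using cmp_add_right[OF i'(1) uvi v(1)] i'(2) cmp_assoc[OF vi m(1) v(1)] v(2) id_left[OF vi]
    by simp
  then have 1: "v \<bullet> i' = \<zero>\<^bsub>Hom C D L\<^esub>"
    using add_eq_self_iff[OF cmp_mor[OF i'(1) v(1)] vi] by simp
  have "p \<bullet> (u \<bullet> (v \<bullet> i)) = \<zero>\<^bsub>Hom C D D\<^esub>"
    using cmp_assoc[OF vi m(1,4)] e(3) cmp_zero_left[OF vi D] by simp
  then have 2: "p \<bullet> i' = idm C D"
    using cmp_add_right[OF i'(1) uvi m(4)] i'(2) e(2) add_zero_right[OF cmp_mor[OF i'(1) m(4)]]
    by simp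
  have Q: "u \<bullet> (v \<bullet> i) \<bullet> p \<in> mor C W W" using cmp_mor[OF m(4) uvi] .
  have P': "i' \<bullet> p \<in> mor C W W" using cmp_mor[OF m(4) i'(1)] .
  have X: "u \<bullet> v' \<in> mor C W W" using cmp_mor[OF m(3,1)] .
  have ip: "i' \<bullet> p \<oplus>\<^bsub>Hom C W W\<^esub> u \<bullet> (v \<bullet> i) \<bullet> p = i \<bullet> p"
    using cmp_add_left[OF m(4) i'(1) uvi] i'(2) by simp
  have "u \<bullet> v \<bullet> u = u" using cmp_assoc[OF m(1) v(1) m(1)] v(2) id_right[OF m(1)] by simp
  then have "u \<bullet> v' \<oplus>\<^bsub>Hom C W W\<^esub> u \<bullet> (v \<bullet> i) \<bullet> p = u \<bullet> v"
    using biproduct_expand_left[OF B uv] cmp_assoc[OF m(2) v(1) m(1)] by simp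
  then have "u \<bullet> v \<oplus>\<^bsub>Hom C W W\<^esub> i' \<bullet> p
      = u \<bullet> v' \<oplus>\<^bsub>Hom C W W\<^esub> (u \<bullet> (v \<bullet> i) \<bullet> p \<oplus>\<^bsub>Hom C W W\<^esub> i' \<bullet> p)"
    using add_assoc[OF X Q P'] by simp
  also have "\<dots> = idm C W"
    using add_commute[OF Q P'] ip e(5) by simp
  finally have "u \<bullet> v \<oplus>\<^bsub>Hom C W W\<^esub> i' \<bullet> p = idm C W" .
  then have "biproduct C L D W u i' v p"
    unfolding biproduct_def using m e v i'(1) 1 2 by simp
  then show ?thesis ..
qed

lemma biproduct_change_section:
  assumes "biproduct C L D W u' i v p" and "u \<in> mor C L W" "v \<bullet> u = idm C L"
  shows "\<exists>p'. biproduct C L D W u i v p'"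
  using linear_category.biproduct_change_retraction[OF linear_category_opposite,
      of L D W v p u' i u] assms by simp

end

text \<open>
  The exchange property of \<open>A\<close>: every section out of \<open>A\<close> with every retraction \<open>v\<close> of it
  belongs to a direct sum decomposition; equivalently, the idempotent \<open>1 - uv\<close> splits whenever
  \<open>vu = 1\<close>.
\<close>

definition complemented :: "('o, 'm, 'k) lin_cat \<Rightarrow> 'o \<Rightarrow> bool" where
  "complemented C A \<longleftrightarrow> A \<in> Obj C \<and>
     (\<forall>W. \<forall>u\<in>mor C A W. \<forall>v\<in>mor C W A. v \<cdot>\<^bsub>C\<^esub> u = idm C A \<longrightarrow>
        (\<exists>D i p. biproduct C A D W u i v p))"

context linear_category
begin

lemma complemented_zero_object:
  assumes "zero_object C N"
  shows "complemented C N"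
proof -
  have N: "N \<in> Obj C" and id0: "idm C N = \<zero>\<^bsub>Hom C N N\<^esub>" using assms zero_object_iff by auto
  have "biproduct C N W W u (idm C W) v (idm C W)"
    if u: "u \<in> mor C N W" and v: "v \<in> mor C W N" and vu: "v \<bullet> u = idm C N" for W u v
  proof -
    have W: "W \<in> Obj C" using u mor_Obj by blast
    note idW = id_mor[OF W]
    have u0: "u = \<zero>\<^bsub>Hom C N W\<^esub>" using id_right[OF u] cmp_zero_right[OF u N] id0 by simp
    have v0: "v = \<zero>\<^bsub>Hom C W N\<^esub>" using id_left[OF v] cmp_zero_left[OF v N] id0 by simp
    have "u \<bullet> v = \<zero>\<^bsub>Hom C W W\<^esub>" using u0 cmp_zero_left[OF v W] by simp
    then show ?thesis
      unfolding biproduct_def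
      using u v vu idW id_left[OF idW] id_left[OF u] id_right[OF v] u0 v0 add_zero_left[OF idW]
      by simp
  qed
  then show ?thesis unfolding complemented_def using N by blast
qed

lemma complemented_iso:
  assumes B: "complemented C B" and "is_iso C B a A"
  shows "complemented C A"
proof -
  obtain b where a: "a \<in> mor C B A" and b: "b \<in> mor C A B"
    and ba: "b \<bullet> a = idm C B" and ab: "a \<bullet> b = idm C A"
    using assms(2) by (auto simp: is_iso_def)
  have "\<exists>D i p. biproduct C A D W u i v p"
    if u: "u \<in> mor C A W" and v: "v \<in> mor C W A" and vu: "v \<bullet> u = idm C A" for W u v
  proof -
    have ua: "u \<bullet> a \<in> mor C B W" and bv: "b \<bullet> v \<in> mor C W B" using u v a b cmp_mor by blast+
    have "(b \<bullet> v) \<bullet> (u \<bullet> a) = idm C B"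
      using cmp_assoc[OF ua v b] cmp_assoc[OF a u v] vu id_left[OF a] ba by simp
    then obtain D i p where "biproduct C B D W (u \<bullet> a) i (b \<bullet> v) p"
      using B ua bv unfolding complemented_def by blast
    from biproduct_iso_left[OF this b a ab ba]
    have "biproduct C A D W (u \<bullet> a \<bullet> b) i (a \<bullet> (b \<bullet> v)) p" .
    then have "biproduct C A D W u i v p"
      using cmp_assoc[OF b a u] cmp_assoc[OF v b a] ab id_right[OF u] id_left[OF v] by simp
    then show ?thesis by blast
  qed
  then show ?thesis unfolding complemented_def using a mor_Obj by blast
qed

text \<open>
  Complements are taken in two steps: \<open>D\<close> is a complement of \<open>A\<^sub>1\<close> in \<open>W\<close>. The composite
  \<open>A\<^sub>2 \<rightarrow> W \<rightarrow> D\<close> is again a section because \<open>D\<close> contains the part of \<open>u\<close> that comes from \<open>A\<^sub>2\<close>, so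
  \<open>A\<^sub>2\<close> has a complement \<open>E\<close> in \<open>D\<close>, and \<open>E\<close> is the complement of \<open>A\<close>.
\<close>

lemma complemented_biproduct:
  assumes B: "biproduct C A\<^sub>1 A\<^sub>2 A i\<^sub>1 i\<^sub>2 p\<^sub>1 p\<^sub>2"
    and A1: "complemented C A\<^sub>1" and A2: "complemented C A\<^sub>2"
  shows "complemented C A"
proof -
  note m = biproduct_mor[OF B] and e = biproduct_eqs[OF B]
  have "\<exists>E i p. biproduct C A E W u i v p"
    if u: "u \<in> mor C A W" and v: "v \<in> mor C W A" and vu: "v \<bullet> u = idm C A" for W u v
  proof -
    \<comment> \<open>Applied to every composite \<open>A\<^sub>k \<rightarrow> A \<rightarrow> W \<rightarrow> A \<rightarrow> A\<^sub>l\<close>.\<close>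
    have vu_cancel: "(b \<bullet> v) \<bullet> (u \<bullet> a) = b \<bullet> a"
      if a: "a \<in> mor C V A" and b: "b \<in> mor C A V'" for a b V V'
      using cmp_assoc[OF cmp_mor[OF a u] v b] cmp_assoc[OF a u v] vu id_left[OF a] by simp
    note ui1 = cmp_mor[OF m(1) u] and ui2 = cmp_mor[OF m(2) u]
      and p1v = cmp_mor[OF v m(3)] and p2v = cmp_mor[OF v m(4)]
    have "(p\<^sub>1 \<bullet> v) \<bullet> (u \<bullet> i\<^sub>1) = idm C A\<^sub>1" using vu_cancel m e by simp
    then obtain D j q where BD: "biproduct C A\<^sub>1 D W (u \<bullet> i\<^sub>1) j (p\<^sub>1 \<bullet> v) q"
      using A1 ui1 p1v unfolding complemented_def by blast
    note mD = biproduct_mor[OF BD] and eD = biproduct_eqs[OF BD]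
    have s: "q \<bullet> (u \<bullet> i\<^sub>2) \<in> mor C A\<^sub>2 D" using cmp_mor[OF ui2 mD(4)] .
    have r: "p\<^sub>2 \<bullet> v \<bullet> j \<in> mor C D A\<^sub>2" using cmp_mor[OF mD(2) p2v] .
    have "(p\<^sub>1 \<bullet> v) \<bullet> (u \<bullet> i\<^sub>2) = \<zero>\<^bsub>Hom C A\<^sub>2 A\<^sub>1\<^esub>" using vu_cancel m e by simp
    then have js: "j \<bullet> (q \<bullet> (u \<bullet> i\<^sub>2)) = u \<bullet> i\<^sub>2"
      using biproduct_expand_right[OF BD ui2] cmp_zero_right[OF ui1 mor_Obj(1)[OF m(2)]]
        add_zero_left[OF cmp_mor[OF s mD(2)]] by simp
    have "(p\<^sub>2 \<bullet> v) \<bullet> (u \<bullet> i\<^sub>1) = \<zero>\<^bsub>Hom C A\<^sub>1 A\<^sub>2\<^esub>" using vu_cancel m e by simp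
    then have rq: "p\<^sub>2 \<bullet> v \<bullet> j \<bullet> q = p\<^sub>2 \<bullet> v"
      using biproduct_expand_left[OF BD p2v] cmp_zero_left[OF p1v mor_Obj(2)[OF m(4)]]
        add_zero_left[OF cmp_mor[OF mD(4) r]] by simp
    have "p\<^sub>2 \<bullet> v \<bullet> j \<bullet> (q \<bullet> (u \<bullet> i\<^sub>2)) = idm C A\<^sub>2"
      using cmp_assoc[OF s mD(2) p2v] js vu_cancel[OF m(2,4)] e(2) by simp
    then obtain E j' q' where
      BE: "biproduct C A\<^sub>2 E D (q \<bullet> (u \<bullet> i\<^sub>2)) j' (p\<^sub>2 \<bullet> v \<bullet> j) q'"
      using A2 s r unfolding complemented_def by blast
    note mE = biproduct_mor[OF BE] and eE = biproduct_eqs[OF BE]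
    have E: "E \<in> Obj C" using mE mor_Obj by blast
    have jj: "j \<bullet> j' \<in> mor C E W" using cmp_mor[OF mE(2) mD(2)] .
    have qq: "q' \<bullet> q \<in> mor C W E" using cmp_mor[OF mD(4) mE(4)] .
    have 1: "(q' \<bullet> q) \<bullet> (j \<bullet> j') = idm C E"
      using cmp_assoc[OF jj mD(4) mE(4)] cmp_assoc[OF mE(2) mD(2,4)] eD(2) id_left[OF mE(2)] eE(2)
      by simp
    have qqu: "q' \<bullet> q \<bullet> u \<in> mor C A E" using cmp_mor[OF u qq] .
    have "q' \<bullet> q \<bullet> u \<bullet> i\<^sub>1 = \<zero>\<^bsub>Hom C A\<^sub>1 E\<^esub>"
      using cmp_assoc[OF m(1) u qq] cmp_assoc[OF ui1 mD(4) mE(4)] eD(3)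
        cmp_zero_right[OF mE(4) mor_Obj(1)[OF m(1)]] by simp
    moreover have "q' \<bullet> q \<bullet> u \<bullet> i\<^sub>2 = \<zero>\<^bsub>Hom C A\<^sub>2 E\<^esub>"
      using cmp_assoc[OF m(2) u qq] cmp_assoc[OF ui2 mD(4) mE(4)] eE(3) by simp
    ultimately have 2: "q' \<bullet> q \<bullet> u = \<zero>\<^bsub>Hom C A E\<^esub>"
      using biproduct_expand_left[OF B qqu] cmp_zero_left[OF m(3) E] cmp_zero_left[OF m(4) E]
        add_zero_left[OF zero_mor[OF mor_Obj(2)[OF m(1)] E]] by simp
    have vjj: "v \<bullet> (j \<bullet> j') \<in> mor C E A" using cmp_mor[OF jj v] .
    have "p\<^sub>1 \<bullet> (v \<bullet> (j \<bullet> j')) = \<zero>\<^bsub>Hom C E A\<^sub>1\<^esub>"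
      using cmp_assoc[OF jj v m(3)] cmp_assoc[OF mE(2) mD(2) p1v] eD(4)
        cmp_zero_left[OF mE(2) mor_Obj(2)[OF m(3)]] by simp
    moreover have "p\<^sub>2 \<bullet> (v \<bullet> (j \<bullet> j')) = \<zero>\<^bsub>Hom C E A\<^sub>2\<^esub>"
      using cmp_assoc[OF jj v m(4)] cmp_assoc[OF mE(2) mD(2) p2v] eE(4) by simp
    ultimately have 3: "v \<bullet> (j \<bullet> j') = \<zero>\<^bsub>Hom C E A\<^esub>"
      using biproduct_expand_right[OF B vjj] cmp_zero_right[OF m(1) E] cmp_zero_right[OF m(2) E]
        add_zero_left[OF zero_mor[OF E mor_Obj(2)[OF m(1)]]] by simp
    note x = cmp_mor[OF p1v ui1] and y = cmp_mor[OF p2v ui2] and z = cmp_mor[OF qq jj]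
    have rqW: "p\<^sub>2 \<bullet> v \<bullet> j \<bullet> q \<in> mor C W A\<^sub>2" using cmp_mor[OF mD(4) r] .
    have jqW: "j' \<bullet> (q' \<bullet> q) \<in> mor C W D" using cmp_mor[OF qq mE(2)] .
    have "j \<bullet> (q \<bullet> (u \<bullet> i\<^sub>2) \<bullet> (p\<^sub>2 \<bullet> v \<bullet> j \<bullet> q)) \<oplus>\<^bsub>Hom C W W\<^esub> j \<bullet> (j' \<bullet> (q' \<bullet> q)) = j \<bullet> q"
      using biproduct_expand_right[OF BE mD(4)] cmp_add_right[OF cmp_mor[OF rqW s] jqW mD(2)]
      by simp
    then have jq: "(u \<bullet> i\<^sub>2) \<bullet> (p\<^sub>2 \<bullet> v) \<oplus>\<^bsub>Hom C W W\<^esub> (j \<bullet> j') \<bullet> (q' \<bullet> q) = j \<bullet> q"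
      using cmp_assoc[OF rqW s mD(2)] js rq cmp_assoc[OF qq mE(2) mD(2)] by simp
    have "u \<bullet> (i\<^sub>1 \<bullet> (p\<^sub>1 \<bullet> v)) \<oplus>\<^bsub>Hom C W W\<^esub> u \<bullet> (i\<^sub>2 \<bullet> (p\<^sub>2 \<bullet> v)) = u \<bullet> v"
      using biproduct_expand_right[OF B v]
        cmp_add_right[OF cmp_mor[OF p1v m(1)] cmp_mor[OF p2v m(2)] u] by simp
    then have "u \<bullet> v = (u \<bullet> i\<^sub>1) \<bullet> (p\<^sub>1 \<bullet> v) \<oplus>\<^bsub>Hom C W W\<^esub> (u \<bullet> i\<^sub>2) \<bullet> (p\<^sub>2 \<bullet> v)"
      using cmp_assoc[OF p1v m(1) u] cmp_assoc[OF p2v m(2) u] by simp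
    then have "u \<bullet> v \<oplus>\<^bsub>Hom C W W\<^esub> (j \<bullet> j') \<bullet> (q' \<bullet> q) = idm C W"
      using add_assoc[OF x y z] jq eD(5) by simp
    then have "biproduct C A E W u (j \<bullet> j') v (q' \<bullet> q)"
      unfolding biproduct_def using u v vu jj qq 1 2 3 by simp
    then show ?thesis by blast
  qed
  then show ?thesis unfolding complemented_def using m mor_Obj by blast
qed

text \<open>
  Locality passes from two summands to finitely many. Summing over endomorphisms of \<open>W\<close>, rather
  than of \<open>L\<close>, lets the decomposition of \<open>id\<^sub>W\<close> be inserted directly.
\<close>

lemma local_summand:
  assumes L: "local_object C L" and u: "u \<in> mor C L W" and v: "v \<in> mor C W L"
    and "finite S" and e: "\<forall>j\<in>S. e j \<in> mor C W W"
    and iso: "is_iso C L (v \<bullet> (\<Oplus>\<^bsub>Hom C W W\<^esub>j\<in>S. e j) \<bullet> u) L"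
  shows "\<exists>j\<in>S. is_iso C L (v \<bullet> e j \<bullet> u) L"
proof -
  have W: "W \<in> Obj C" and LO: "L \<in> Obj C" using u mor_Obj by blast+
  interpret H: abelian_group "Hom C W W" using Hom_abelian_group W by blast
  show ?thesis
    using \<open>finite S\<close> e iso
  proof (induction S rule: finite_induct)
    case empty
    then have "is_iso C L \<zero>\<^bsub>Hom C L L\<^esub> L"
      using cmp_zero_right[OF v W] cmp_zero_left[OF u LO] by simp
    then obtain w where w: "w \<in> mor C L L" "w \<bullet> \<zero>\<^bsub>Hom C L L\<^esub> = idm C L"
      by (auto simp: is_iso_def)
    then show ?case using cmp_zero_right[OF w(1) LO] L by (simp add: local_object_def)
  next
    case (insert k S)
    let ?E = "\<Oplus>\<^bsub>Hom C W W\<^esub>j\<in>S. e j"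
    have c: "e k \<in> carrier (Hom C W W)" "e \<in> S \<rightarrow> carrier (Hom C W W)"
      using insert.prems mor_carrier by auto
    have sum: "(\<Oplus>\<^bsub>Hom C W W\<^esub>j\<in>insert k S. e j) = e k \<oplus>\<^bsub>Hom C W W\<^esub> ?E"
      using insert.hyps c by (intro H.finsum_insert)
    have E: "?E \<in> mor C W W" using H.finsum_closed[OF c(2)] W by (simp add: mor_iff)
    have ek: "e k \<in> mor C W W" using insert.prems by simp
    note vek = cmp_mor[OF ek v] and vE = cmp_mor[OF E v]
    have "v \<bullet> (\<Oplus>\<^bsub>Hom C W W\<^esub>j\<in>insert k S. e j) \<bullet> u
        = v \<bullet> e k \<bullet> u \<oplus>\<^bsub>Hom C L L\<^esub> v \<bullet> ?E \<bullet> u"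
      using sum cmp_add_right[OF ek E v] cmp_add_left[OF u vek vE] by simp
    then consider "is_iso C L (v \<bullet> e k \<bullet> u) L" | "is_iso C L (v \<bullet> ?E \<bullet> u) L"
      using local_object_sum_iso[OF L cmp_mor[OF u vek] cmp_mor[OF u vE]] insert.prems by auto
    then show ?case using insert.IH insert.prems by cases auto
  qed
qed

end

text \<open>
  A partial sum of the summands of a direct sum is again an object of the category, and an object \<open>B\<close>
  realizing it is built from the zero object by adding one summand at a time. The predicate \<open>Q\<close>
  transports a property along this construction. The orthogonality of \<open>B\<close> to the remaining
  summands is what makes the next step work, and it turns \<open>B\<close> into a complement when all summands but
  one are taken.
\<close>

lemma (in k_category) direct_subsum:
  assumes W: "direct_sum C n X W i p"
    and zero: "\<And>N. zero_object C N \<Longrightarrow> Q N"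
    and bip: "\<And>A A' B i\<^sub>1 i\<^sub>2 p\<^sub>1 p\<^sub>2. biproduct C A A' B i\<^sub>1 i\<^sub>2 p\<^sub>1 p\<^sub>2 \<Longrightarrow> Q A \<Longrightarrow> Q A' \<Longrightarrow> Q B"
    and summand: "\<And>j. j < n \<Longrightarrow> Q (X j)"
    and S: "S \<subseteq> {..<n}"
  shows "\<exists>B a b. Q B \<and> a \<in> mor C B W \<and> b \<in> mor C W B \<and> b \<bullet> a = idm C B \<and>
    a \<bullet> b = (\<Oplus>\<^bsub>Hom C W W\<^esub>j\<in>S. i j \<bullet> p j) \<and>
    (\<forall>l<n. l \<notin> S \<longrightarrow> p l \<bullet> a = \<zero>\<^bsub>Hom C B (X l)\<^esub> \<and> b \<bullet> i l = \<zero>\<^bsub>Hom C (X l) B\<^esub>)"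
proof -
  have WO: "W \<in> Obj C" using W by (simp add: direct_sum_def)
  have im: "i j \<in> mor C (X j) W" and pm: "p j \<in> mor C W (X j)" if "j < n" for j
    using W that by (auto simp: direct_sum_def)
  have pi: "p l \<bullet> i j = (if j = l then idm C (X j) else \<zero>\<^bsub>Hom C (X j) (X l)\<^esub>)"
    if "j < n" "l < n" for j l
    using W that by (auto simp: direct_sum_def)
  have XO: "X j \<in> Obj C" if "j < n" for j using im that mor_Obj by blast
  interpret H: abelian_group "Hom C W W" using Hom_abelian_group WO by blast
  have "finite S" using S finite_subset by blast
  then show ?thesis
    using S
  proof (induction S rule: finite_induct)
    case empty
    obtain N where N: "zero_object C N" using zero_object_exists by blast
    then have NO: "N \<in> Obj C" and id0: "idm C N = \<zero>\<^bsub>Hom C N N\<^esub>" using zero_object_iff by auto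
    note a = zero_mor[OF NO WO] and b = zero_mor[OF WO NO]
    have "\<zero>\<^bsub>Hom C W N\<^esub> \<bullet> \<zero>\<^bsub>Hom C N W\<^esub> = idm C N" using cmp_zero_right[OF b NO] id0 by simp
    moreover have "\<zero>\<^bsub>Hom C N W\<^esub> \<bullet> \<zero>\<^bsub>Hom C W N\<^esub> = (\<Oplus>\<^bsub>Hom C W W\<^esub>j\<in>{}. i j \<bullet> p j)"
      using cmp_zero_right[OF a WO] by simp
    moreover have "p l \<bullet> \<zero>\<^bsub>Hom C N W\<^esub> = \<zero>\<^bsub>Hom C N (X l)\<^esub> \<and> \<zero>\<^bsub>Hom C W N\<^esub> \<bullet> i l = \<zero>\<^bsub>Hom C (X l) N\<^esub>"
      if "l < n" for l
      using cmp_zero_right[OF pm[OF that] NO] cmp_zero_left[OF im[OF that] NO] by simp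
    ultimately show ?case using zero[OF N] a b by blast
  next
    case (insert k S)
    then have k: "k < n" and kS: "k \<notin> S" by auto
    obtain B a b where B: "Q B" "a \<in> mor C B W" "b \<in> mor C W B" "b \<bullet> a = idm C B"
      and ab: "a \<bullet> b = (\<Oplus>\<^bsub>Hom C W W\<^esub>j\<in>S. i j \<bullet> p j)"
      and orth: "\<And>l. \<lbrakk>l < n; l \<notin> S\<rbrakk> \<Longrightarrow> p l \<bullet> a = \<zero>\<^bsub>Hom C B (X l)\<^esub>"
        "\<And>l. \<lbrakk>l < n; l \<notin> S\<rbrakk> \<Longrightarrow> b \<bullet> i l = \<zero>\<^bsub>Hom C (X l) B\<^esub>"
      using insert by auto
    have BO: "B \<in> Obj C" using B mor_Obj by blast
    obtain B' j1 j2 q1 q2 where B': "biproduct C B (X k) B' j1 j2 q1 q2"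
      using biproduct_exists BO XO[OF k] by blast
    note m = biproduct_mor[OF B'] and e = biproduct_eqs[OF B']
    have B'O: "B' \<in> Obj C" using m mor_Obj by blast
    define a' where "a' = a \<bullet> q1 \<oplus>\<^bsub>Hom C B' W\<^esub> i k \<bullet> q2"
    define b' where "b' = j1 \<bullet> b \<oplus>\<^bsub>Hom C W B'\<^esub> j2 \<bullet> p k"
    note aq = cmp_mor[OF m(3) B(2)] and iq = cmp_mor[OF m(4) im[OF k]]
      and jb = cmp_mor[OF B(3) m(1)] and jp = cmp_mor[OF pm[OF k] m(2)]
    have a': "a' \<in> mor C B' W" unfolding a'_def using add_mor aq iq by blast
    have b': "b' \<in> mor C W B'" unfolding b'_def using add_mor jb jp by blast
    have a'j1: "a' \<bullet> j1 = a"
      unfolding a'_def using cmp_add_left[OF m(1) aq iq] cmp_assoc[OF m(1,3) B(2)]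
        cmp_assoc[OF m(1,4) im[OF k]] e id_right[OF B(2)] cmp_zero_right[OF im[OF k] BO]
        add_zero_right[OF B(2)] by simp
    have a'j2: "a' \<bullet> j2 = i k"
      unfolding a'_def using cmp_add_left[OF m(2) aq iq] cmp_assoc[OF m(2,3) B(2)]
        cmp_assoc[OF m(2,4) im[OF k]] e id_right[OF im[OF k]] cmp_zero_right[OF B(2) XO[OF k]]
        add_zero_left[OF im[OF k]] by simp
    have b'a: "b' \<bullet> a = j1"
      unfolding b'_def using cmp_add_left[OF B(2) jb jp] cmp_assoc[OF B(2,3) m(1)]
        cmp_assoc[OF B(2) pm[OF k] m(2)] B(4) orth(1)[OF k kS] id_right[OF m(1)]
        cmp_zero_right[OF m(2) BO] add_zero_right[OF m(1)] by simp
    have b'i: "b' \<bullet> i k = j2"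
      unfolding b'_def using cmp_add_left[OF im[OF k] jb jp] cmp_assoc[OF im[OF k] B(3) m(1)]
        cmp_assoc[OF im[OF k] pm[OF k] m(2)] pi[OF k k] orth(2)[OF k kS] id_right[OF m(2)]
        cmp_zero_right[OF m(1) XO[OF k]] add_zero_left[OF m(2)] by simp
    have "b' \<bullet> a' \<bullet> j1 \<bullet> q1 \<oplus>\<^bsub>Hom C B' B'\<^esub> b' \<bullet> a' \<bullet> j2 \<bullet> q2 = b' \<bullet> a'"
      using biproduct_expand_left[OF B' cmp_mor[OF a' b']] .
    then have 1: "b' \<bullet> a' = idm C B'"
      using cmp_assoc[OF m(1) a' b'] cmp_assoc[OF m(2) a' b'] a'j1 a'j2 b'a b'i e(5) by simp
    have c: "i k \<bullet> p k \<in> carrier (Hom C W W)" "(\<lambda>j. i j \<bullet> p j) \<in> S \<rightarrow> carrier (Hom C W W)"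
      using insert.prems cmp_mor[OF pm im] mor_carrier by auto
    have "a' \<bullet> b' = a \<bullet> b \<oplus>\<^bsub>Hom C W W\<^esub> i k \<bullet> p k"
      using cmp_add_right[OF jb jp a'] cmp_assoc[OF B(3) m(1) a'] cmp_assoc[OF pm[OF k] m(2) a']
        a'j1 a'j2 by (simp add: b'_def)
    also have "\<dots> = i k \<bullet> p k \<oplus>\<^bsub>Hom C W W\<^esub> a \<bullet> b"
      using add_commute[OF cmp_mor[OF B(3,2)] cmp_mor[OF pm[OF k] im[OF k]]] .
    also have "\<dots> = (\<Oplus>\<^bsub>Hom C W W\<^esub>j\<in>insert k S. i j \<bullet> p j)"
      using H.finsum_insert[OF insert.hyps c(2,1)] ab by simp
    finally have 2: "a' \<bullet> b' = (\<Oplus>\<^bsub>Hom C W W\<^esub>j\<in>insert k S. i j \<bullet> p j)" .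
    have 3: "p l \<bullet> a' = \<zero>\<^bsub>Hom C B' (X l)\<^esub>" if l: "l < n" "l \<notin> insert k S" for l
    proof -
      have "p l \<bullet> (a \<bullet> q1) = \<zero>\<^bsub>Hom C B' (X l)\<^esub>"
        using cmp_assoc[OF m(3) B(2) pm[OF l(1)]] orth(1)[of l] l cmp_zero_left[OF m(3) XO[OF l(1)]]
        by simp
      moreover have "p l \<bullet> (i k \<bullet> q2) = \<zero>\<^bsub>Hom C B' (X l)\<^esub>"
        using cmp_assoc[OF m(4) im[OF k] pm[OF l(1)]] pi[OF k l(1)] l
          cmp_zero_left[OF m(4) XO[OF l(1)]] by simp
      ultimately show ?thesis
        unfolding a'_def using cmp_add_right[OF aq iq pm[OF l(1)]]
          add_zero_left[OF zero_mor[OF B'O XO[OF l(1)]]] by simp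
    qed
    have 4: "b' \<bullet> i l = \<zero>\<^bsub>Hom C (X l) B'\<^esub>" if l: "l < n" "l \<notin> insert k S" for l
    proof -
      have "j1 \<bullet> b \<bullet> i l = \<zero>\<^bsub>Hom C (X l) B'\<^esub>"
        using cmp_assoc[OF im[OF l(1)] B(3) m(1)] orth(2)[of l] l cmp_zero_right[OF m(1) XO[OF l(1)]]
        by simp
      moreover have "j2 \<bullet> p k \<bullet> i l = \<zero>\<^bsub>Hom C (X l) B'\<^esub>"
        using cmp_assoc[OF im[OF l(1)] pm[OF k] m(2)] pi[OF l(1) k] l
          cmp_zero_right[OF m(2) XO[OF l(1)]] by simp
      ultimately show ?thesis
        unfolding b'_def using cmp_add_left[OF im[OF l(1)] jb jp]
          add_zero_left[OF zero_mor[OF XO[OF l(1)] B'O]] by simp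
    qed
    show ?case using bip[OF B' B(1) summand[OF k]] a' b' 1 2 3 4 by blast
  qed
qed

context krull_schmidt_category
begin

text \<open>
  Exchange. Decompose \<open>W\<close> into local objects \<open>X\<^sub>j\<close>. The identity \<open>vu\<close> of \<open>L\<close> is the sum of the
  \<open>v i\<^sub>j p\<^sub>j u\<close>, so one of these is invertible, and then \<open>p\<^sub>j u : L \<rightarrow> X\<^sub>j\<close> is an isomorphism because
  \<open>X\<^sub>j\<close> is local. Hence \<open>L\<close> takes the place of \<open>X\<^sub>j\<close>, and the sum of the other summands is a complement.
\<close>

lemma complemented_if_local:
  assumes L: "local_object C L"
  shows "complemented C L"
proof -
  have LO: "L \<in> Obj C" and idL: "idm C L \<noteq> \<zero>\<^bsub>Hom C L L\<^esub>"
    using L by (auto simp: local_object_def)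
  have "\<exists>D i p. biproduct C L D W u i v p"
    if u: "u \<in> mor C L W" and v: "v \<in> mor C W L" and vu: "v \<bullet> u = idm C L" for W u v
  proof -
    have W: "W \<in> Obj C" using u mor_Obj by blast
    obtain n X i p where ds: "direct_sum C n X W i p"
      and loc: "\<And>j. j < n \<Longrightarrow> local_ring (end_ring C (X j))"
      using krull_schmidt[OF W] by blast
    have im: "i j \<in> mor C (X j) W" and pm: "p j \<in> mor C W (X j)"
      and pi: "p j \<bullet> i j = idm C (X j)" if "j < n" for j
      using ds that by (auto simp: direct_sum_def)
    have total: "(\<Oplus>\<^bsub>Hom C W W\<^esub>j\<in>{..<n}. i j \<bullet> p j) = idm C W"
      using ds by (simp add: direct_sum_def)
    have ip: "\<forall>j\<in>{..<n}. i j \<bullet> p j \<in> mor C W W" using cmp_mor[OF pm im] by auto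
    have "is_iso C L (idm C L) L" using id_mor[OF LO] id_left unfolding is_iso_def by blast
    then have "is_iso C L (v \<bullet> (\<Oplus>\<^bsub>Hom C W W\<^esub>j\<in>{..<n}. i j \<bullet> p j) \<bullet> u) L"
      using total vu id_right[OF v] by simp
    then obtain j where j: "j < n" and iso: "is_iso C L (v \<bullet> (i j \<bullet> p j) \<bullet> u) L"
      using local_summand[OF L u v _ ip] by auto
    have vi: "v \<bullet> i j \<in> mor C (X j) L" using cmp_mor[OF im[OF j] v] .
    have pu: "p j \<bullet> u \<in> mor C L (X j)" using cmp_mor[OF u pm[OF j]] .
    have "v \<bullet> (i j \<bullet> p j) \<bullet> u = v \<bullet> i j \<bullet> (p j \<bullet> u)"
      using cmp_assoc[OF pm[OF j] im[OF j] v] cmp_assoc[OF u pm[OF j] vi] by simp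
    then obtain w where w: "w \<in> mor C L L" "w \<bullet> (v \<bullet> i j \<bullet> (p j \<bullet> u)) = idm C L"
      using iso by (auto simp: is_iso_def)
    \<comment> \<open>The inverse of the isomorphism \<open>p\<^sub>j u\<close>.\<close>
    define r where "r = w \<bullet> (v \<bullet> i j)"
    have r: "r \<in> mor C (X j) L" unfolding r_def using cmp_mor[OF vi w(1)] .
    have r1: "r \<bullet> (p j \<bullet> u) = idm C L" unfolding r_def using cmp_assoc[OF pu vi w(1)] w(2) by simp
    have Xj: "local_object C (X j)"
      using local_object_if_local_ring[OF mor_Obj(1)[OF im[OF j]] loc[OF j]] .
    have r2: "(p j \<bullet> u) \<bullet> r = idm C (X j)" using section_into_local_object[OF Xj idL pu r r1] .
    obtain B a b where a: "a \<in> mor C B W" and b: "b \<in> mor C W B" and ba: "b \<bullet> a = idm C B"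
      and ab: "a \<bullet> b = (\<Oplus>\<^bsub>Hom C W W\<^esub>l\<in>{..<n} - {j}. i l \<bullet> p l)"
      and pa: "p j \<bullet> a = \<zero>\<^bsub>Hom C B (X j)\<^esub>" and bi: "b \<bullet> i j = \<zero>\<^bsub>Hom C (X j) B\<^esub>"
      using direct_subsum[OF ds, of "\<lambda>_. True" "{..<n} - {j}"] j by auto
    interpret H: abelian_group "Hom C W W" using Hom_abelian_group W by blast
    have c: "i j \<bullet> p j \<in> carrier (Hom C W W)"
      "(\<lambda>l. i l \<bullet> p l) \<in> {..<n} - {j} \<rightarrow> carrier (Hom C W W)"
      using ip j mor_carrier by auto
    have "i j \<bullet> p j \<oplus>\<^bsub>Hom C W W\<^esub> a \<bullet> b = idm C W"
      using H.finsum_insert[OF _ _ c(2,1)] ab total insert_Diff[of j "{..<n}"] j by simp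
    then have "biproduct C (X j) B W (i j) a (p j) b"
      unfolding biproduct_def using a b ba pa bi im pm pi j by simp
    then have B1: "biproduct C L B W (i j \<bullet> (p j \<bullet> u)) a (r \<bullet> p j) b"
      using biproduct_iso_left[OF _ pu r r1 r2] by blast
    \<comment> \<open>So far \<open>L\<close> sits in \<open>W\<close> along \<open>i\<^sub>j p\<^sub>j u\<close>; now correct the section to \<open>u\<close>, then the retraction to \<open>v\<close>.\<close>
    have "r \<bullet> p j \<bullet> u = idm C L" using cmp_assoc[OF u pm[OF j] r] r1 by simp
    then obtain p' where "biproduct C L B W u a (r \<bullet> p j) p'"
      using biproduct_change_section[OF B1 u] by blast
    then show ?thesis using biproduct_change_retraction[OF _ v vu] by blast
  qed
  then show ?thesis unfolding complemented_def using LO by blast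
qed

lemma all_complemented:
  assumes A: "A \<in> Obj C"
  shows "complemented C A"
proof -
  obtain n X i p where ds: "direct_sum C n X A i p"
    and loc: "\<And>j. j < n \<Longrightarrow> local_ring (end_ring C (X j))"
    using krull_schmidt[OF A] by blast
  have comp_X: "complemented C (X j)" if "j < n" for j
  proof -
    have "i j \<in> mor C (X j) A" using ds that by (simp add: direct_sum_def)
    then show ?thesis
      using complemented_if_local[OF local_object_if_local_ring[OF mor_Obj(1) loc[OF that]]] by blast
  qed
  have "\<exists>B a b. complemented C B \<and> a \<in> mor C B A \<and> b \<in> mor C A B \<and> b \<bullet> a = idm C B \<and>
      a \<bullet> b = (\<Oplus>\<^bsub>Hom C A A\<^esub>j\<in>{..<n}. i j \<bullet> p j) \<and>
      (\<forall>l<n. l \<notin> {..<n} \<longrightarrow> p l \<bullet> a = \<zero>\<^bsub>Hom C B (X l)\<^esub> \<and> b \<bullet> i l = \<zero>\<^bsub>Hom C (X l) B\<^esub>)"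
    by (rule direct_subsum[OF ds])
      (blast intro: complemented_zero_object complemented_biproduct comp_X)+
  then obtain B a b where B: "complemented C B" and "a \<in> mor C B A" and "b \<in> mor C A B"
    and "b \<bullet> a = idm C B" and "a \<bullet> b = (\<Oplus>\<^bsub>Hom C A A\<^esub>j\<in>{..<n}. i j \<bullet> p j)"
    by blast
  then have "is_iso C B a A" using ds unfolding is_iso_def direct_sum_def by auto
  then show ?thesis using complemented_iso B by blast
qed

end


section \<open>Irreducible morphisms\<close>

lemma (in linear_category) AR_sequence_split_middle:
  assumes AR: "AR_sequence C X f Y g Z" and B: "biproduct C Y\<^sub>1 Y\<^sub>2 Y i\<^sub>1 i\<^sub>2 p\<^sub>1 p\<^sub>2"
  shows "AR_sequence_biproduct C X (p\<^sub>1 \<bullet> f) (p\<^sub>2 \<bullet> f) Y\<^sub>1 Y\<^sub>2 (g \<bullet> i\<^sub>1) (g \<bullet> i\<^sub>2) Z"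
proof -
  note f = AR_sequence_mor(1)[OF AR] and g = AR_sequence_mor(2)[OF AR] and m = biproduct_mor[OF B]
  have "AR_sequence C X (i\<^sub>1 \<bullet> (p\<^sub>1 \<bullet> f) \<oplus>\<^bsub>Hom C X Y\<^esub> i\<^sub>2 \<bullet> (p\<^sub>2 \<bullet> f))
      Y (g \<bullet> i\<^sub>1 \<bullet> p\<^sub>1 \<oplus>\<^bsub>Hom C Y Z\<^esub> g \<bullet> i\<^sub>2 \<bullet> p\<^sub>2) Z"
    using AR biproduct_expand_left[OF B g] biproduct_expand_right[OF B f] by simp
  then show ?thesis
    unfolding AR_sequence_biproduct_def
    using B cmp_mor[OF f m(3)] cmp_mor[OF f m(4)] cmp_mor[OF m(1) g] cmp_mor[OF m(2) g] by blast
qed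

context krull_schmidt_category
begin

text \<open>
  Both lemmas below need the decomposition of the middle term to extend a prescribed morphism: here the
  first projection is forced to be \<open>h\<close>, and in the next lemma the first injection is forced
  to be \<open>s\<close>.
\<close>

lemma AR_sequence_extends_irreducible_start:
  assumes AR: "AR_sequence C X f Y g Z" and irr: "irreducible_mor C X f\<^sub>1 Y\<^sub>1"
  shows "\<exists>f\<^sub>2 Y\<^sub>2 g\<^sub>1 g\<^sub>2. AR_sequence_biproduct C X f\<^sub>1 f\<^sub>2 Y\<^sub>1 Y\<^sub>2 g\<^sub>1 g\<^sub>2 Z"
proof -
  have f1: "f\<^sub>1 \<in> mor C X Y\<^sub>1" "\<not> is_section C X f\<^sub>1 Y\<^sub>1" using irr by (auto simp: irreducible_mor_def)
  have las: "left_almost_split C X f Y"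
    using AR by (simp add: AR_sequence_def minimal_left_almost_split_def)
  then obtain h where h: "h \<in> mor C Y Y\<^sub>1" "f\<^sub>1 = h \<bullet> f"
    using f1 unfolding left_almost_split_def by blast
  moreover have "\<not> is_section C X f Y" using las by (simp add: left_almost_split_def)
  ultimately have "is_retraction C Y h Y\<^sub>1"
    using irr AR_sequence_mor(1)[OF AR] unfolding irreducible_mor_def by blast
  then obtain s where "s \<in> mor C Y\<^sub>1 Y" "h \<bullet> s = idm C Y\<^sub>1" by (auto simp: is_retraction_def)
  then obtain D i p where "biproduct C Y\<^sub>1 D Y s i h p"
    using all_complemented[OF mor_Obj(2)[OF h(1)]] h unfolding complemented_def by blast
  from AR_sequence_split_middle[OF AR this] show ?thesis using h(2) by blast
qed

lemma AR_sequence_extends_irreducible_end: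
  assumes AR: "AR_sequence C X f Y g Z" and irr: "irreducible_mor C Y\<^sub>1 g\<^sub>1 Z"
  shows "\<exists>f\<^sub>1 f\<^sub>2 Y\<^sub>2 g\<^sub>2. AR_sequence_biproduct C X f\<^sub>1 f\<^sub>2 Y\<^sub>1 Y\<^sub>2 g\<^sub>1 g\<^sub>2 Z"
proof -
  have g1: "g\<^sub>1 \<in> mor C Y\<^sub>1 Z" "\<not> is_retraction C Y\<^sub>1 g\<^sub>1 Z"
    using irr by (auto simp: irreducible_mor_def)
  have ras: "right_almost_split C Y g Z"
    using AR by (simp add: AR_sequence_def minimal_right_almost_split_def)
  then obtain s where s: "s \<in> mor C Y\<^sub>1 Y" "g\<^sub>1 = g \<bullet> s"
    using g1 unfolding right_almost_split_def by blast
  moreover have "\<not> is_retraction C Y g Z" using ras by (simp add: right_almost_split_def)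
  ultimately have "is_section C Y\<^sub>1 s Y"
    using irr AR_sequence_mor(2)[OF AR] unfolding irreducible_mor_def by blast
  then obtain r where "r \<in> mor C Y Y\<^sub>1" "r \<bullet> s = idm C Y\<^sub>1" by (auto simp: is_section_def)
  then obtain D i p where "biproduct C Y\<^sub>1 D Y s i r p"
    using all_complemented[OF mor_Obj(1)[OF s(1)]] s unfolding complemented_def by blast
  from AR_sequence_split_middle[OF AR this] show ?thesis using s(2) by blast
qed

end

theorem theorem4p9:
  fixes K :: "('k, 'c) ring_scheme" and C :: "('o, 'm, 'k) lin_cat"
  assumes "cring K"
    and "krull_schmidt_category K C"
    and "AR_sequence C X f Y g Z"
    and "\<not> zero_object C Y"
  shows "(\<forall>f' Y' g' Z'. AR_sequence C X f' Y' g' Z' \<longrightarrow>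
            sequence_iso C X f' Y' g' Z' X f Y g Z) \<and>
         (\<forall>X' f' Y' g'. AR_sequence C X' f' Y' g' Z \<longrightarrow>
            sequence_iso C X' f' Y' g' Z X f Y g Z) \<and>
         (\<forall>f\<^sub>1 Y\<^sub>1. irreducible_mor C X f\<^sub>1 Y\<^sub>1 \<longrightarrow>
            (\<exists>f\<^sub>2 Y\<^sub>2 g\<^sub>1 g\<^sub>2. AR_sequence_biproduct C X f\<^sub>1 f\<^sub>2 Y\<^sub>1 Y\<^sub>2 g\<^sub>1 g\<^sub>2 Z)) \<and>
         (\<forall>g\<^sub>1 Y\<^sub>1. irreducible_mor C Y\<^sub>1 g\<^sub>1 Z \<longrightarrow>
            (\<exists>f\<^sub>1 f\<^sub>2 Y\<^sub>2 g\<^sub>2. AR_sequence_biproduct C X f\<^sub>1 f\<^sub>2 Y\<^sub>1 Y\<^sub>2 g\<^sub>1 g\<^sub>2 Z))"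
proof -
  interpret krull_schmidt_category K C by fact
  note AR = assms(3) and Y = assms(4)
  have "sequence_iso C X f' Y' g' Z' X f Y g Z" if "AR_sequence C X f' Y' g' Z'" for f' Y' g' Z'
    using sequence_iso_sym[OF AR_sequence_unique_start[OF AR that Y]] AR_sequence_mor(1,2)[OF AR]
      AR_sequence_mor(1,2)[OF that] by blast
  then show ?thesis
    using AR_sequence_unique_end[OF AR _ Y] AR_sequence_extends_irreducible_start[OF AR]
      AR_sequence_extends_irreducible_end[OF AR] by blast
qed

end
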